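(* Let $r\in\,]0,1[$, $B$ a Banach space and $\Lambda_0\in\mathcal R$. If $a\in\mathcal S(r,B)$, the function $q\mapsto(q-\Lambda_0)\big(\Sigma_{\mathcal R}(a)\big)(q)$ belongs to $\mathcal G_1(\Lambda_0,B)$, and the constant term in its asymptotic expansion $J_{\Lambda_0}\big((q-\Lambda_0)\Sigma_{\mathcal R}(a)\big)$ is equal to $a_{\Lambda_0}$. In particular, if $0<r_2<r_1$, the solution $F_{r_1,r_2}$ belongs to $(q-\Lambda_0)^{-1}\mathcal G_1\big(\Lambda_0,\mathcal L(B_{r_1},B_{r_2})\big)$, and the constant term in $J_{\Lambda_0}\big((q-\Lambda_0)F_{r_1,r_2}\big)$ is the operator $\Lambda_0\mathcal L_{m(\Lambda_0)}\odot$.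
   Context: $\mathbb D=\{|q|<1\}$, $\mathbb E=\{|q|>1\}$, $\mathbb S^1=\{|q|=1\}$, $\mathbb D_r=\{|z|<r\}$. $\mathcal R$ is the set of all complex roots of unity; for $\Lambda\in\mathcal R$, $m(\Lambda)=\min\{m\ge1:\Lambda^m=1\}$. **Borel-Wolff-Denjoy series.** $\mathcal S(r,B)$ is the set of families $a=(a_\Lambda)_{\Lambda\in\mathcal R}$ in $B$ for which there is $c>0$ with $\|a_\Lambda\|\le c\,r^{m(\Lambda)}/m(\Lambda)$ for all $\Lambda$. For such $a$ and $q\in\mathbb D\cup\mathbb E$, $(\Sigma_{\mathcal R}(a))(q)=\sum_{\Lambda\in\mathcal R}\frac{a_\Lambda}{q-\Lambda}$. **Gevrey-1 class.** For $\lambda\in\mathbb S^1$, $\mathcal G_1(\lambda,B)$ is the space of $B$-valued functions $f$ for which there exist open disks $\Delta^-\subset\mathbb D$, $\Delta^+\subset\mathbb E$ tangent to $\mathbb S^1$ at $\lambda$ on which $f$ is holomorphic, a single formal series $\sum_{n\ge0}a_nQ^n\in B[[Q]]$ and $c_0,c_1>0$ such that $\|f(q)-\sum_{0\le n\le N-1}a_n(q-\lambda)^n\|\le c_0c_1^N\,\Gamma(1+N)\,|q-\lambda|^N$ for all $N\ge0$ and $q\in\Delta^-\cup\Delta^+$. This series is the asymptotic expansion $J_\lambda(f)$. **Solution of the cohomological equation.** $B_r$ is the Banach space of bounded holomorphic functions on $\mathbb D_r$ vanishing at $0$ (sup norm), $\mathcal L(B_{r_1},B_{r_2})$ is the space of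 bounded linear operators, and $(\sum A_nz^n)\odot(\sum B_nz^n)=\sum A_nB_nz^n$ is the Hadamard product. For $0<r_2<r_1$ and $q\in\mathbb D\cup\mathbb E$, $F_{r_1,r_2}(q)\in\mathcal L(B_{r_1},B_{r_2})$ is the operator $g=\sum_{n\ge1}g_nz^n\mapsto\sum_{n\ge1}g_n\frac{z^n}{q^n-1}$. $\mathcal L_m(z)=-\frac1m\log(1-z^m)$, and $\mathcal L_m\odot$ denotes the operator $g\mapsto\mathcal L_m\odot g$. *)

theory Defs
  imports "HOL-Complex_Analysis.Complex_Analysis" "HOL-Library.Function_Algebras"
begin

section \<open>Complex Banach spaces on carrier sets\<close>

text \<open>
  The space of bounded operators between two spaces of functions on disks of variable radii is not
  a type, so Banach spaces are given by a carrier set, closed under the vector space operations of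
  an ambient type. A Banach space that is a type of its own is the case of the carrier
  \<^term>\<open>UNIV\<close>.  The scalar multiplication is a parameter because the libraries have no class of
  complex vector spaces.
\<close>

record 'b cspace =
  vecs :: "'b set"
  smul :: "complex \<Rightarrow> 'b \<Rightarrow> 'b"
  nrm :: "'b \<Rightarrow> real"

definition complex_normed_space :: "'b::ab_group_add cspace \<Rightarrow> bool" where
  "complex_normed_space B \<longleftrightarrow>
     vector_space (smul B) \<and> module.subspace (smul B) (vecs B) \<and>
     (\<forall>x\<in>vecs B. 0 \<le> nrm B x \<and> (nrm B x = 0 \<longleftrightarrow> x = 0)) \<and>
     (\<forall>c. \<forall>x\<in>vecs B. nrm B (smul B c x) = cmod c * nrm B x) \<and>
     (\<forall>x\<in>vecs B. \<forall>y\<in>vecs B. nrm B (x + y) \<le> nrm B x + nrm B y)"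

definition complex_banach_space :: "'b::ab_group_add cspace \<Rightarrow> bool" where
  "complex_banach_space B \<longleftrightarrow>
     complex_normed_space B \<and>
     (\<forall>X :: nat \<Rightarrow> 'b. range X \<subseteq> vecs B \<and>
        (\<forall>e>0. \<exists>M. \<forall>m\<ge>M. \<forall>n\<ge>M. nrm B (X m - X n) < e) \<longrightarrow>
        (\<exists>x\<in>vecs B. (\<lambda>n. nrm B (X n - x)) \<longlonglongrightarrow> 0))"

definition norm_tendsto ::
    "'b::ab_group_add cspace \<Rightarrow> ('i \<Rightarrow> 'b) \<Rightarrow> 'b \<Rightarrow> 'i filter \<Rightarrow> bool" where
  "norm_tendsto B f l F \<longleftrightarrow> l \<in> vecs B \<and> ((\<lambda>i. nrm B (f i - l)) \<longlongrightarrow> 0) F"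

definition vec_holomorphic_on ::
    "'b::ab_group_add cspace \<Rightarrow> (complex \<Rightarrow> 'b) \<Rightarrow> complex set \<Rightarrow> bool" where
  "vec_holomorphic_on B f S \<longleftrightarrow>
     (\<forall>z\<in>S. f z \<in> vecs B \<and>
        (\<exists>D. norm_tendsto B (\<lambda>w. smul B (1 / (w - z)) (f w - f z)) D (at z within S)))"

text \<open>Unconditional sums, as in \<^term>\<open>infsum\<close>, but with respect to the norm of \<open>B\<close>.\<close>

definition vec_infsum :: "'b::ab_group_add cspace \<Rightarrow> ('i \<Rightarrow> 'b) \<Rightarrow> 'i set \<Rightarrow> 'b" where
  "vec_infsum B f A = (THE s. norm_tendsto B (\<lambda>X. sum f X) s (finite_subsets_at_top A))"

text \<open>
  Addition and zero of operators are pointwise. Operators vanish outside the carrier of their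
  domain, so that equality of operators is equality on that carrier.
\<close>

definition bounded_operators ::
    "'v::ab_group_add cspace \<Rightarrow> 'w::ab_group_add cspace \<Rightarrow> ('v \<Rightarrow> 'w) cspace" where
  "bounded_operators V W =
     \<lparr>vecs = {T. (\<forall>x\<in>vecs V. T x \<in> vecs W) \<and> (\<forall>x. x \<notin> vecs V \<longrightarrow> T x = 0) \<and>
               (\<forall>x\<in>vecs V. \<forall>y\<in>vecs V. T (x + y) = T x + T y) \<and>
               (\<forall>c. \<forall>x\<in>vecs V. T (smul V c x) = smul W c (T x)) \<and>
               (\<exists>K. \<forall>x\<in>vecs V. nrm W (T x) \<le> K * nrm V x)},
      smul = (\<lambda>c T x. smul W c (T x)),
      nrm = (\<lambda>T. SUP x\<in>{x \<in> vecs V. nrm V x \<le> 1}. nrm W (T x))\<rparr>"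

section \<open>Borel-Wolff-Denjoy series\<close>

definition unity_roots :: "complex set" where
  "unity_roots = {\<Lambda>. \<exists>m::nat. m \<ge> 1 \<and> \<Lambda> ^ m = 1}"

definition root_order :: "complex \<Rightarrow> nat" where
  "root_order \<Lambda> = (LEAST m. m \<ge> 1 \<and> \<Lambda> ^ m = 1)"

definition bwd_families :: "real \<Rightarrow> 'b::ab_group_add cspace \<Rightarrow> (complex \<Rightarrow> 'b) set" where
  "bwd_families r B =
     {a. (\<forall>\<Lambda>\<in>unity_roots. a \<Lambda> \<in> vecs B) \<and>
         (\<exists>c>0. \<forall>\<Lambda>\<in>unity_roots. nrm B (a \<Lambda>) \<le> c * r ^ root_order \<Lambda> / real (root_order \<Lambda>))}"

definition bwd_series :: "'b::ab_group_add cspace \<Rightarrow> (complex \<Rightarrow> 'b) \<Rightarrow> complex \<Rightarrow> 'b" where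
  "bwd_series B a q = vec_infsum B (\<lambda>\<Lambda>. smul B (1 / (q - \<Lambda>)) (a \<Lambda>)) unity_roots"

section \<open>Gevrey-1 asymptotics at a point of the unit circle\<close>

text \<open>Tangency of two circles: their having exactly one common point.\<close>

definition disk_tangent_at :: "complex \<Rightarrow> complex set \<Rightarrow> bool" where
  "disk_tangent_at l \<Delta> \<longleftrightarrow>
     (\<exists>p \<rho>. 0 < \<rho> \<and> \<Delta> = ball p \<rho> \<and> sphere p \<rho> \<inter> sphere 0 1 = {l})"

text \<open>The type \<open>'b fps\<close> only serves as the type of coefficient sequences of formal series.\<close>

definition gevrey1_expansion ::
    "complex \<Rightarrow> 'b::ab_group_add cspace \<Rightarrow> (complex \<Rightarrow> 'b) \<Rightarrow> 'b fps \<Rightarrow> bool" where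
  "gevrey1_expansion l B f a \<longleftrightarrow>
     (\<forall>n. fps_nth a n \<in> vecs B) \<and>
     (\<exists>\<Delta>m \<Delta>p c0 c1.
        \<Delta>m \<subseteq> {q. cmod q < 1} \<and> disk_tangent_at l \<Delta>m \<and>
        \<Delta>p \<subseteq> {q. cmod q > 1} \<and> disk_tangent_at l \<Delta>p \<and>
        vec_holomorphic_on B f (\<Delta>m \<union> \<Delta>p) \<and> 0 < c0 \<and> 0 < c1 \<and>
        (\<forall>N. \<forall>q\<in>\<Delta>m \<union> \<Delta>p.
           nrm B (f q - (\<Sum>n<N. smul B ((q - l) ^ n) (fps_nth a n)))
             \<le> c0 * c1 ^ N * Gamma (1 + real N) * cmod (q - l) ^ N))"

definition gevrey1 :: "complex \<Rightarrow> 'b::ab_group_add cspace \<Rightarrow> (complex \<Rightarrow> 'b) set" where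
  "gevrey1 l B = {f. \<exists>a. gevrey1_expansion l B f a}"

definition asymp_expansion ::
    "complex \<Rightarrow> 'b::ab_group_add cspace \<Rightarrow> (complex \<Rightarrow> 'b) \<Rightarrow> 'b fps" where
  "asymp_expansion l B f = (THE a. gevrey1_expansion l B f a)"

section \<open>The cohomological equation\<close>

text \<open>Functions on the disk of radius \<open>r\<close> are extended by zero.\<close>

definition bounded_hol :: "real \<Rightarrow> (complex \<Rightarrow> complex) cspace" where
  "bounded_hol r =
     \<lparr>vecs = {g. g holomorphic_on ball 0 r \<and> bounded (g ` ball 0 r) \<and> g 0 = 0 \<and>
               (\<forall>z. z \<notin> ball 0 r \<longrightarrow> g z = 0)},
      smul = (\<lambda>c g z. c * g z),
      nrm = (\<lambda>g. SUP z\<in>ball 0 r. cmod (g z))\<rparr>"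

definition hol_operators ::
    "real \<Rightarrow> real \<Rightarrow> ((complex \<Rightarrow> complex) \<Rightarrow> complex \<Rightarrow> complex) cspace" where
  "hol_operators r1 r2 = bounded_operators (bounded_hol r1) (bounded_hol r2)"

text \<open>
  The prescription \<open>T\<close> as an operator between these spaces: it is applied only to elements of the
  domain, and the resulting functions are cut off to the disk of radius \<open>r2\<close>.
\<close>

definition as_operator ::
    "real \<Rightarrow> real \<Rightarrow> ((complex \<Rightarrow> complex) \<Rightarrow> complex \<Rightarrow> complex) \<Rightarrow>
     (complex \<Rightarrow> complex) \<Rightarrow> complex \<Rightarrow> complex" where
  "as_operator r1 r2 T =
     (\<lambda>g z. if g \<in> vecs (bounded_hol r1) \<and> z \<in> ball 0 r2 then T g z else 0)"

definition cohom_solution ::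
    "real \<Rightarrow> real \<Rightarrow> complex \<Rightarrow> (complex \<Rightarrow> complex) \<Rightarrow> complex \<Rightarrow> complex" where
  "cohom_solution r1 r2 q =
     as_operator r1 r2
       (\<lambda>g z. \<Sum>n. fps_nth (fps_expansion g 0) (Suc n) * (z ^ Suc n / (q ^ Suc n - 1)))"

definition hadamard_prod ::
    "(complex \<Rightarrow> complex) \<Rightarrow> (complex \<Rightarrow> complex) \<Rightarrow> complex \<Rightarrow> complex" where
  "hadamard_prod f g z =
     (\<Sum>n. fps_nth (fps_expansion f 0) n * fps_nth (fps_expansion g 0) n * z ^ n)"

definition log_fun :: "nat \<Rightarrow> complex \<Rightarrow> complex" where
  "log_fun m z = - (1 / of_nat m) * ln (1 - z ^ m)"

end

theory Submission
  imports Defs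
begin

text \<open>
  Multiplied by \<open>q - \<Lambda>\<^sub>0\<close>, the series is the sum of the scalar kernels
  \<open>(q - \<Lambda>\<^sub>0) / (q - \<Lambda>)\<close> against the family \<open>a\<close>. For \<open>\<Lambda> \<noteq> \<Lambda>\<^sub>0\<close> such a kernel is
  a geometric series in \<open>(q - \<Lambda>\<^sub>0) / (\<Lambda> - \<Lambda>\<^sub>0)\<close>, and truncating it after \<open>N\<close> terms leaves an error
  with the factors \<open>\<bar>\<Lambda> - \<Lambda>\<^sub>0\<bar>\<^sup>-\<^sup>N\<close> and \<open>\<bar>q - \<Lambda>\<bar>\<^sup>-\<^sup>1\<close>. Distinct roots of unity satisfy
  \<open>\<bar>\<Lambda> - \<Lambda>\<^sub>0\<bar> \<ge> 1 / (m(\<Lambda>) m(\<Lambda>\<^sub>0))\<close>, and since a disk tangent to the circle at \<open>\<Lambda>\<^sub>0\<close> leaves the circle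
  to second order, \<open>\<bar>q - \<Lambda>\<bar> \<ge> \<bar>\<Lambda> - \<Lambda>\<^sub>0\<bar>\<^sup>2 / 4\<close> there. The remainder is therefore at most a moment
  \<open>\<Sum> m(\<Lambda>)\<^sup>N\<^sup>+\<^sup>2 r\<^sup>m / m(\<Lambda>)\<close>, which grows like \<open>C\<^sup>N N!\<close>. The kernel at \<open>\<Lambda>\<^sub>0\<close> itself is \<open>1\<close>, whence the
  constant term.

  For the cohomological equation, the partial fractions of \<open>1 / (q\<^sup>n - 1)\<close> exhibit the solution as the series
  with coefficients \<open>\<Lambda> \<L>\<^sub>m \<odot>\<close>, where \<open>m = m(\<Lambda>)\<close>. Their norms are at most a constant times
  \<open>(r\<^sub>2 / r\<^sub>1)\<^sup>m / m\<close> by Cauchy's estimates.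
\<close>

section \<open>Unconditional sums in Banach spaces on carrier sets\<close>

locale complex_normed =
  fixes B :: "'b::ab_group_add cspace"
  assumes normed: "complex_normed_space B"

sublocale complex_normed \<subseteq> vector_space "smul B"
  using normed by (simp add: complex_normed_space_def)

context complex_normed
begin

lemma carrier: "subspace (vecs B)"
  using normed by (simp add: complex_normed_space_def)

lemma zero_mem [simp]: "0 \<in> vecs B"
  and add_mem: "x \<in> vecs B \<Longrightarrow> y \<in> vecs B \<Longrightarrow> x + y \<in> vecs B"
  and diff_mem: "x \<in> vecs B \<Longrightarrow> y \<in> vecs B \<Longrightarrow> x - y \<in> vecs B"
  and smul_mem: "x \<in> vecs B \<Longrightarrow> smul B c x \<in> vecs B"
  and sum_mem: "(\<And>i. i \<in> I \<Longrightarrow> f i \<in> vecs B) \<Longrightarrow> sum f I \<in> vecs B"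
  using carrier by (auto intro: subspace_0 subspace_add subspace_diff subspace_scale subspace_sum)

lemma nrm_nonneg: "x \<in> vecs B \<Longrightarrow> 0 \<le> nrm B x"
  and nrm_eq_0: "x \<in> vecs B \<Longrightarrow> nrm B x = 0 \<longleftrightarrow> x = 0"
  and nrm_smul: "x \<in> vecs B \<Longrightarrow> nrm B (smul B c x) = cmod c * nrm B x"
  and nrm_triangle: "x \<in> vecs B \<Longrightarrow> y \<in> vecs B \<Longrightarrow> nrm B (x + y) \<le> nrm B x + nrm B y"
  using normed unfolding complex_normed_space_def by blast+

lemma nrm_zero [simp]: "nrm B 0 = 0"
  using nrm_eq_0[of 0] by simp

lemma nrm_minus: "x \<in> vecs B \<Longrightarrow> nrm B (- x) = nrm B x"
  using nrm_smul[of x "-1"] by simp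

lemma nrm_minus_commute: "x \<in> vecs B \<Longrightarrow> y \<in> vecs B \<Longrightarrow> nrm B (x - y) = nrm B (y - x)"
  using nrm_minus[of "x - y"] diff_mem[of x y] by simp

lemma nrm_triangle_diff:
  assumes "x \<in> vecs B" "y \<in> vecs B" "z \<in> vecs B"
  shows "nrm B (x - z) \<le> nrm B (x - y) + nrm B (y - z)"
  using nrm_triangle[of "x - y" "y - z"] diff_mem assms by (simp add: algebra_simps)

lemma nrm_le_add_diff:
  assumes "x \<in> vecs B" "y \<in> vecs B"
  shows "nrm B x \<le> nrm B y + nrm B (x - y)"
  using nrm_triangle[of "y" "x - y"] diff_mem assms by simp

lemma nrm_sum_le:
  assumes "\<And>i. i \<in> I \<Longrightarrow> f i \<in> vecs B"
  shows "nrm B (sum f I) \<le> (\<Sum>i\<in>I. nrm B (f i))"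
  using assms
proof (induction I rule: infinite_finite_induct)
  case (insert i I)
  then show ?case
    using nrm_triangle[of "f i" "sum f I"] sum_mem[of I f] by force
qed simp_all

text \<open>The triangle inequality is available only inside the carrier, so the values have to lie
  there eventually. It bounds the distance of the two limits by a quantity tending to 0.\<close>

lemma norm_tendsto_unique:
  assumes f: "norm_tendsto B f x F" "norm_tendsto B f y F"
    and mem: "eventually (\<lambda>i. f i \<in> vecs B) F" and F: "F \<noteq> bot"
  shows "x = y"
proof -
  have xy: "x \<in> vecs B" "y \<in> vecs B"
    using f by (auto simp: norm_tendsto_def)
  have lim: "((\<lambda>i. nrm B (f i - x) + nrm B (f i - y)) \<longlongrightarrow> 0) F"
    using f tendsto_add[of "\<lambda>i. nrm B (f i - x)" 0 F "\<lambda>i. nrm B (f i - y)" 0]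
    by (simp add: norm_tendsto_def)
  have "eventually (\<lambda>i. nrm B (x - y) \<le> nrm B (f i - x) + nrm B (f i - y)) F"
    using mem
  proof eventually_elim
    case (elim i)
    then show ?case
      using nrm_triangle_diff[of x "f i" y] nrm_minus_commute[of x "f i"] xy by simp
  qed
  then have "nrm B (x - y) \<le> 0"
    using tendsto_lowerbound[OF lim _ F] by blast
  then show ?thesis
    using nrm_nonneg[of "x - y"] nrm_eq_0[of "x - y"] diff_mem xy by force
qed

lemma norm_tendsto_bound:
  assumes f: "norm_tendsto B f x F"
    and le: "eventually (\<lambda>i. f i \<in> vecs B \<and> nrm B (f i) \<le> C) F" and F: "F \<noteq> bot"
  shows "nrm B x \<le> C"
proof -
  have x: "x \<in> vecs B" and lim: "((\<lambda>i. C + nrm B (f i - x)) \<longlongrightarrow> C + 0) F"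
    using f tendsto_add[OF tendsto_const, of "\<lambda>i. nrm B (f i - x)" 0 F C] by (auto simp: norm_tendsto_def)
  have "eventually (\<lambda>i. nrm B x \<le> C + nrm B (f i - x)) F"
    using le
  proof eventually_elim
    case (elim i)
    then show ?case
      using nrm_le_add_diff[of x "f i"] nrm_minus_commute[of x "f i"] x by simp
  qed
  then show ?thesis
    using tendsto_lowerbound[OF lim _ F] by simp
qed

lemma norm_tendsto_add:
  assumes f: "norm_tendsto B f x F" and g: "norm_tendsto B g y F"
    and mem: "eventually (\<lambda>i. f i \<in> vecs B \<and> g i \<in> vecs B) F"
  shows "norm_tendsto B (\<lambda>i. f i + g i) (x + y) F"
proof -
  have xy: "x \<in> vecs B" "y \<in> vecs B"
    using f g by (auto simp: norm_tendsto_def)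
  have lim: "((\<lambda>i. nrm B (f i - x) + nrm B (g i - y)) \<longlongrightarrow> 0) F"
    using f g tendsto_add[of "\<lambda>i. nrm B (f i - x)" 0 F "\<lambda>i. nrm B (g i - y)" 0]
    by (simp add: norm_tendsto_def)
  have "((\<lambda>i. nrm B (f i + g i - (x + y))) \<longlongrightarrow> 0) F"
  proof (rule tendsto_sandwich[OF _ _ tendsto_const lim])
    show "\<forall>\<^sub>F i in F. 0 \<le> nrm B (f i + g i - (x + y))"
      using mem by eventually_elim (auto intro!: nrm_nonneg diff_mem add_mem xy)
    show "\<forall>\<^sub>F i in F. nrm B (f i + g i - (x + y)) \<le> nrm B (f i - x) + nrm B (g i - y)"
      using mem
    proof eventually_elim
      case (elim i)
      then show ?case
        using nrm_triangle[of "f i - x" "g i - y"] xy diff_mem by (simp add: algebra_simps)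
    qed
  qed
  then show ?thesis
    using xy by (simp add: norm_tendsto_def add_mem)
qed

lemma norm_tendsto_smul:
  assumes f: "norm_tendsto B f x F" and mem: "eventually (\<lambda>i. f i \<in> vecs B) F"
  shows "norm_tendsto B (\<lambda>i. smul B c (f i)) (smul B c x) F"
proof -
  have x: "x \<in> vecs B" and lim: "((\<lambda>i. cmod c * nrm B (f i - x)) \<longlongrightarrow> cmod c * 0) F"
    using f tendsto_mult_left[of "\<lambda>i. nrm B (f i - x)" 0 F "cmod c"] by (auto simp: norm_tendsto_def)
  have "eventually (\<lambda>i. cmod c * nrm B (f i - x) = nrm B (smul B c (f i) - smul B c x)) F"
    using mem
    by eventually_elim (use x in \<open>simp add: nrm_smul diff_mem flip: scale_right_diff_distrib\<close>)
  then have "((\<lambda>i. nrm B (smul B c (f i) - smul B c x)) \<longlongrightarrow> 0) F"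
    using lim by (simp add: filterlim_cong)
  then show ?thesis
    using x by (simp add: norm_tendsto_def smul_mem)
qed

text \<open>Uniqueness of limits makes the definite description in \<open>vec_infsum\<close> pick
  out any limit that has been exhibited.\<close>

lemma vec_infsum_eqI:
  assumes "norm_tendsto B (sum f) s (finite_subsets_at_top A)" and "\<And>i. i \<in> A \<Longrightarrow> f i \<in> vecs B"
  shows "vec_infsum B f A = s"
proof -
  have "eventually (\<lambda>X. sum f X \<in> vecs B) (finite_subsets_at_top A)"
    using assms(2) by (intro eventually_finite_subsets_at_top_weakI sum_mem) blast
  then show ?thesis
    unfolding vec_infsum_def
    using assms(1) norm_tendsto_unique[of "sum f"] by (intro the_equality) auto
qed

end

section \<open>Absolutely summable families in a Banach space\<close>

locale complex_banach =
  fixes B :: "'b::ab_group_add cspace"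
  assumes banach: "complex_banach_space B"

sublocale complex_banach \<subseteq> complex_normed
  using banach by unfold_locales (simp add: complex_banach_space_def)

context complex_banach
begin

text \<open>Completeness speaks of sequences, the unconditional sum of the net of finite subsets.
  Finite sets \<open>X n\<close> that exhaust the majorant \<open>u\<close> up to 1/(n+1) give a
  Cauchy sequence of partial sums, and its limit is then the limit of the whole net.\<close>

lemma abs_summable_converges:
  assumes f: "\<And>i. i \<in> A \<Longrightarrow> f i \<in> vecs B" and fu: "\<And>i. i \<in> A \<Longrightarrow> nrm B (f i) \<le> u i"
    and u: "u summable_on A"
  shows "\<exists>s. norm_tendsto B (sum f) s (finite_subsets_at_top A)"
proof -
  have u0: "0 \<le> u i" if "i \<in> A" for i
    using f[OF that] fu[OF that] nrm_nonneg order_trans by blast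
  have "\<exists>X. finite X \<and> X \<subseteq> A \<and> infsum u A - sum u X < e" if "e > 0" for e
  proof -
    have "(sum u \<longlongrightarrow> infsum u A) (finite_subsets_at_top A)"
      using u by (simp add: infsum_tendsto)
    then have "eventually (\<lambda>X. dist (sum u X) (infsum u A) < e) (finite_subsets_at_top A)"
      using that by (rule tendstoD)
    then show ?thesis
      unfolding eventually_finite_subsets_at_top by (force simp: dist_real_def)
  qed
  then have "\<exists>X. \<forall>n. finite (X n) \<and> X n \<subseteq> A \<and> infsum u A - sum u (X n) < 1 / real (Suc n)"
    by (intro choice allI) simp
  then obtain X where X: "\<And>n. finite (X n)" "\<And>n. X n \<subseteq> A"
      "\<And>n. infsum u A - sum u (X n) < 1 / real (Suc n)"
    by blast
  \<comment> \<open>Two finite sets that both carry all but 1/(n+1) of the mass of \<open>u\<close>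
    can differ only by parts of mass below 1/(n+1) on either side of their intersection
    \<open>Z\<close>. The two sides together give the factor 2.\<close>
  have tail: "nrm B (sum f Y - sum f (X n)) < 2 / real (Suc n)"
    if Y: "finite Y" "Y \<subseteq> A" and le: "infsum u A - sum u Y < 1 / real (Suc n)" for Y n
  proof -
    define Z where "Z = X n \<inter> Y"
    have split: "sum f Y = sum f Z + sum f (Y - Z)" "sum f (X n) = sum f Z + sum f (X n - Z)"
      using sum.subset_diff[of Z Y f] sum.subset_diff[of Z "X n" f] Y X by (auto simp: Z_def add.commute)
    have mem: "sum f W \<in> vecs B" if "W \<subseteq> A" for W
      using that f by (intro sum_mem) blast
    have nrm: "nrm B (sum f W) \<le> sum u W" if "W \<subseteq> A" for W
      using that f fu by (intro order_trans[OF nrm_sum_le] sum_mono) auto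
    have sub: "Y - Z \<subseteq> A" "X n - Z \<subseteq> A"
      using X Y by auto
    have "sum u (Y \<union> X n) \<le> infsum u A"
      using X Y u u0 by (intro finite_sum_le_infsum) auto
    moreover have "sum u (Y \<union> X n) = sum u Y + sum u (X n - Z)"
      using X Y by (subst sum.union_disjoint[symmetric]) (auto simp: Z_def intro: arg_cong[where f = "sum u"])
    moreover have "sum u (Y \<union> X n) = sum u (X n) + sum u (Y - Z)"
      using X Y by (subst sum.union_disjoint[symmetric]) (auto simp: Z_def intro: arg_cong[where f = "sum u"])
    ultimately have *: "sum u (X n - Z) < 1 / real (Suc n)" "sum u (Y - Z) < 1 / real (Suc n)"
      using le X(3)[of n] by auto
    have "nrm B (sum f Y - sum f (X n)) = nrm B (sum f (Y - Z) - sum f (X n - Z))"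
      by (simp add: split)
    also have "\<dots> \<le> nrm B (sum f (Y - Z)) + nrm B (sum f (X n - Z))"
      using nrm_triangle_diff[of "sum f (Y - Z)" 0 "sum f (X n - Z)"] mem sub nrm_minus by simp
    also have "\<dots> \<le> sum u (Y - Z) + sum u (X n - Z)"
      using nrm sub by (intro add_mono)
    finally show ?thesis
      using * by simp
  qed
  have mem: "sum f W \<in> vecs B" if "W \<subseteq> A" for W
    using that f by (intro sum_mem) blast
  have "\<exists>s\<in>vecs B. (\<lambda>n. nrm B (sum f (X n) - s)) \<longlonglongrightarrow> 0"
  proof -
    have "\<exists>M. \<forall>m\<ge>M. \<forall>n\<ge>M. nrm B (sum f (X m) - sum f (X n)) < e" if "e > 0" for e
    proof -
      obtain M where M: "inverse (real (Suc M)) < e / 4"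
        using reals_Archimedean[of "e / 4"] \<open>e > 0\<close> by auto
      have *: "nrm B (sum f (X m) - sum f (X M)) < e / 2" if "m \<ge> M" for m
      proof -
        have "infsum u A - sum u (X m) < 1 / real (Suc M)"
          using X(3)[of m] that by (smt (verit) frac_le of_nat_le_iff of_nat_0_less_iff Suc_le_mono zero_less_Suc)
        then have "nrm B (sum f (X m) - sum f (X M)) < 2 * inverse (real (Suc M))"
          using tail[of "X m" M] X by (simp add: inverse_eq_divide)
        then show ?thesis
          using M by linarith
      qed
      have "nrm B (sum f (X m) - sum f (X n)) < e" if "m \<ge> M" "n \<ge> M" for m n
        using *[OF that(1)] *[OF that(2)] nrm_minus_commute[of "sum f (X n)" "sum f (X M)"]
          nrm_triangle_diff[of "sum f (X m)" "sum f (X M)" "sum f (X n)"] mem X by simp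
      then show ?thesis
        by blast
    qed
    then show ?thesis
      using banach mem X unfolding complex_banach_space_def by (metis image_subsetI)
  qed
  then obtain s where s: "s \<in> vecs B" "(\<lambda>n. nrm B (sum f (X n) - s)) \<longlonglongrightarrow> 0"
    by blast
  have "((\<lambda>Y. nrm B (sum f Y - s)) \<longlongrightarrow> 0) (finite_subsets_at_top A)"
  proof (rule tendstoI)
    fix e :: real
    assume e: "e > 0"
    have "eventually (\<lambda>n. nrm B (sum f (X n) - s) < e / 2) sequentially"
      using order_tendstoD(2)[OF s(2), of "e / 2"] e by simp
    moreover have "eventually (\<lambda>n. 1 / real (Suc n) < e / 4) sequentially"
      using order_tendstoD(2)[OF LIMSEQ_inverse_real_of_nat, of "e / 4"] e
      by (simp add: inverse_eq_divide)
    ultimately have "eventually (\<lambda>n. nrm B (sum f (X n) - s) < e / 2 \<and> 1 / real (Suc n) < e / 4) sequentially"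
      by eventually_elim simp
    then obtain n where n: "nrm B (sum f (X n) - s) < e / 2" "1 / real (Suc n) < e / 4"
      unfolding eventually_sequentially by blast
    show "eventually (\<lambda>Y. dist (nrm B (sum f Y - s)) 0 < e) (finite_subsets_at_top A)"
      unfolding eventually_finite_subsets_at_top
    proof (intro exI[of _ "X n"] conjI allI impI)
      fix Y
      assume Y: "finite Y \<and> X n \<subseteq> Y \<and> Y \<subseteq> A"
      have "sum u (X n) \<le> sum u Y"
        using Y u0 by (intro sum_mono2) auto
      then have "nrm B (sum f Y - sum f (X n)) < 2 / real (Suc n)"
        using Y X(3)[of n] by (intro tail) auto
      then have "nrm B (sum f Y - s) < e"
        using n nrm_triangle_diff[of "sum f Y" "sum f (X n)" s] mem Y X s by simp
      then show "dist (nrm B (sum f Y - s)) 0 < e"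
        using nrm_nonneg[of "sum f Y - s"] mem Y s diff_mem by simp
    qed (use X in auto)
  qed
  then show ?thesis
    using s by (auto simp: norm_tendsto_def)
qed

end

text \<open>
  For a family \<open>a\<close> dominated by real weights \<open>w\<close>, the sum of \<open>k i\<close> times \<open>a i\<close> is a bounded linear
  function of the coefficients \<open>k\<close>, with respect to the weighted \<open>\<ell>\<^sup>1\<close>-norm.
\<close>

locale weighted_family = complex_banach B for B :: "'b::ab_group_add cspace" +
  fixes a :: "'i \<Rightarrow> 'b" and w :: "'i \<Rightarrow> real" and A :: "'i set"
  assumes a_mem: "i \<in> A \<Longrightarrow> a i \<in> vecs B"
    and a_le: "i \<in> A \<Longrightarrow> nrm B (a i) \<le> w i"
begin

definition wsum :: "('i \<Rightarrow> complex) \<Rightarrow> 'b" where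
  "wsum k = vec_infsum B (\<lambda>i. smul B (k i) (a i)) A"

definition wsummable :: "('i \<Rightarrow> complex) \<Rightarrow> bool" where
  "wsummable k \<longleftrightarrow> (\<lambda>i. cmod (k i) * w i) summable_on A"

lemma w_nonneg: "i \<in> A \<Longrightarrow> 0 \<le> w i"
  using a_mem a_le nrm_nonneg order_trans by blast

lemma wsummableI:
  assumes "(\<lambda>i. u i * w i) summable_on A" "\<And>i. i \<in> A \<Longrightarrow> cmod (k i) \<le> u i"
  shows "wsummable k"
  unfolding wsummable_def
  by (rule summable_on_comparison_test[OF assms(1)])
    (use assms w_nonneg in \<open>auto intro: mult_right_mono\<close>)

lemma
  assumes "wsummable k"
  shows wsum_tendsto: "norm_tendsto B (sum (\<lambda>i. smul B (k i) (a i))) (wsum k) (finite_subsets_at_top A)"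
    and wsum_mem: "wsum k \<in> vecs B"
    and nrm_wsum_le: "nrm B (wsum k) \<le> (\<Sum>\<^sub>\<infinity>i\<in>A. cmod (k i) * w i)"
proof -
  let ?f = "\<lambda>i. smul B (k i) (a i)"
  note u = assms[unfolded wsummable_def]
  have f: "?f i \<in> vecs B" "nrm B (?f i) \<le> cmod (k i) * w i" if "i \<in> A" for i
    using that a_mem a_le by (auto simp: smul_mem nrm_smul mult_left_mono)
  obtain s where s: "norm_tendsto B (sum ?f) s (finite_subsets_at_top A)"
    using abs_summable_converges[OF f u] by blast
  have [simp]: "wsum k = s"
    unfolding wsum_def using vec_infsum_eqI[OF s] f by blast
  show "norm_tendsto B (sum ?f) (wsum k) (finite_subsets_at_top A)"
    using s by simp
  show "wsum k \<in> vecs B"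
    using s by (simp add: norm_tendsto_def)
  show "nrm B (wsum k) \<le> (\<Sum>\<^sub>\<infinity>i\<in>A. cmod (k i) * w i)"
  proof (rule norm_tendsto_bound)
    show "norm_tendsto B (sum ?f) (wsum k) (finite_subsets_at_top A)"
      using s by simp
    show "\<forall>\<^sub>F X in finite_subsets_at_top A.
        sum ?f X \<in> vecs B \<and> nrm B (sum ?f X) \<le> (\<Sum>\<^sub>\<infinity>i\<in>A. cmod (k i) * w i)"
    proof (rule eventually_finite_subsets_at_top_weakI)
      fix X
      assume X: "finite X" "X \<subseteq> A"
      have "nrm B (sum ?f X) \<le> (\<Sum>i\<in>X. cmod (k i) * w i)"
        using X f by (intro order_trans[OF nrm_sum_le] sum_mono) auto
      also have "\<dots> \<le> (\<Sum>\<^sub>\<infinity>i\<in>A. cmod (k i) * w i)"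
        using X u w_nonneg by (intro finite_sum_le_infsum) auto
      finally show "sum ?f X \<in> vecs B \<and> nrm B (sum ?f X) \<le> (\<Sum>\<^sub>\<infinity>i\<in>A. cmod (k i) * w i)"
        using X f sum_mem[of X ?f] by auto
    qed
  qed simp
qed

lemma nrm_wsum_le':
  assumes u: "(\<lambda>i. u i * w i) summable_on A" and "\<And>i. i \<in> A \<Longrightarrow> cmod (k i) \<le> u i"
  shows "nrm B (wsum k) \<le> (\<Sum>\<^sub>\<infinity>i\<in>A. u i * w i)"
proof -
  have "wsummable k"
    using assms by (rule wsummableI)
  then show ?thesis
    using assms w_nonneg
    by (intro order_trans[OF nrm_wsum_le] infsum_mono) (auto simp: wsummable_def intro: mult_right_mono)
qed

lemma wsummable_add: "wsummable k \<Longrightarrow> wsummable l \<Longrightarrow> wsummable (\<lambda>i. k i + l i)"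
  using wsummableI[of "\<lambda>i. cmod (k i) + cmod (l i)" "\<lambda>i. k i + l i"]
  by (simp add: wsummable_def distrib_right summable_on_add norm_triangle_ineq)

lemma wsummable_cmult: "wsummable k \<Longrightarrow> wsummable (\<lambda>i. c * k i)"
  using summable_on_cmult_right[of "\<lambda>i. cmod (k i) * w i" A "cmod c"]
  by (simp add: wsummable_def norm_mult mult.assoc)

lemma wsum_add:
  assumes "wsummable k" "wsummable l"
  shows "wsum (\<lambda>i. k i + l i) = wsum k + wsum l"
proof -
  let ?f = "\<lambda>k i. smul B (k i) (a i)"
  have mem: "\<forall>\<^sub>F X in finite_subsets_at_top A. sum (?f k) X \<in> vecs B \<and> sum (?f l) X \<in> vecs B"
    by (rule eventually_finite_subsets_at_top_weakI) (use a_mem smul_mem in \<open>auto intro!: sum_mem\<close>)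
  have "norm_tendsto B (sum (?f (\<lambda>i. k i + l i))) (wsum k + wsum l) (finite_subsets_at_top A)"
    using norm_tendsto_add[OF wsum_tendsto[OF assms(1)] wsum_tendsto[OF assms(2)] mem]
    by (simp add: scale_left_distrib sum.distrib[abs_def])
  then show ?thesis
    unfolding wsum_def using vec_infsum_eqI a_mem smul_mem by (metis (no_types, lifting) wsum_def)
qed

lemma wsum_cmult:
  assumes "wsummable k"
  shows "wsum (\<lambda>i. c * k i) = smul B c (wsum k)"
proof -
  let ?f = "\<lambda>k i. smul B (k i) (a i)"
  have mem: "\<forall>\<^sub>F X in finite_subsets_at_top A. sum (?f k) X \<in> vecs B"
    by (rule eventually_finite_subsets_at_top_weakI) (use a_mem smul_mem in \<open>auto intro!: sum_mem\<close>)
  have "norm_tendsto B (sum (?f (\<lambda>i. c * k i))) (smul B c (wsum k)) (finite_subsets_at_top A)"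
    using norm_tendsto_smul[OF wsum_tendsto[OF assms(1)] mem, of c]
    by (simp add: scale_sum_right)
  then show ?thesis
    unfolding wsum_def using vec_infsum_eqI a_mem smul_mem by (metis (no_types, lifting) wsum_def)
qed

lemma wsum_diff:
  assumes "wsummable k" "wsummable l"
  shows "wsum (\<lambda>i. k i - l i) = wsum k - wsum l"
  using wsum_add[OF assms(1) wsummable_cmult[OF assms(2), of "-1"]] wsum_cmult[OF assms(2), of "-1"]
  by simp

lemma
  assumes "\<And>n. n \<in> I \<Longrightarrow> wsummable (k n)"
  shows wsummable_sum: "wsummable (\<lambda>i. \<Sum>n\<in>I. k n i)"
    and wsum_sum: "wsum (\<lambda>i. \<Sum>n\<in>I. k n i) = (\<Sum>n\<in>I. wsum (k n))"
proof -
  have z: "wsummable (\<lambda>i. 0)"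
    by (simp add: wsummable_def)
  have 0: "wsum (\<lambda>i. 0) = 0"
    using wsum_cmult[OF z, of 0] by simp
  have "wsummable (\<lambda>i. \<Sum>n\<in>I. k n i) \<and> wsum (\<lambda>i. \<Sum>n\<in>I. k n i) = (\<Sum>n\<in>I. wsum (k n))"
    using assms
    by (induction I rule: infinite_finite_induct) (simp_all add: z 0 wsummable_add wsum_add)
  then show "wsummable (\<lambda>i. \<Sum>n\<in>I. k n i)" "wsum (\<lambda>i. \<Sum>n\<in>I. k n i) = (\<Sum>n\<in>I. wsum (k n))"
    by auto
qed

end

section \<open>Roots of unity and disks tangent to the unit circle\<close>

lemma
  assumes "\<Lambda> \<in> unity_roots"
  shows root_order_pos: "root_order \<Lambda> > 0" and power_root_order: "\<Lambda> ^ root_order \<Lambda> = 1"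
proof -
  have "root_order \<Lambda> \<ge> 1 \<and> \<Lambda> ^ root_order \<Lambda> = 1"
    using assms unfolding root_order_def unity_roots_def mem_Collect_eq by (rule LeastI_ex)
  then show "root_order \<Lambda> > 0" "\<Lambda> ^ root_order \<Lambda> = 1"
    by auto
qed

lemma unity_rootsI: "\<Lambda> ^ n = 1 \<Longrightarrow> n > 0 \<Longrightarrow> \<Lambda> \<in> unity_roots"
  by (auto simp: unity_roots_def Suc_le_eq)

lemma cmod_unity_root: "\<Lambda> \<in> unity_roots \<Longrightarrow> cmod \<Lambda> = 1"
  using power_root_order root_order_pos
  by (metis norm_one norm_power norm_ge_zero power_eq_1_iff less_numeral_extra(3))

lemma unity_root_nonzero: "\<Lambda> \<in> unity_roots \<Longrightarrow> \<Lambda> \<noteq> 0"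
  using cmod_unity_root by force

lemma power_eq_1_iff_root_order_dvd:
  assumes "\<Lambda> \<in> unity_roots"
  shows "\<Lambda> ^ n = 1 \<longleftrightarrow> root_order \<Lambda> dvd n"
proof
  have "\<Lambda> ^ n = \<Lambda> ^ (root_order \<Lambda> * (n div root_order \<Lambda>) + n mod root_order \<Lambda>)"
    by simp
  also have "\<dots> = \<Lambda> ^ (n mod root_order \<Lambda>)"
    unfolding power_add power_mult using power_root_order[OF assms] by simp
  finally have eq: "\<Lambda> ^ n = \<Lambda> ^ (n mod root_order \<Lambda>)" .
  assume "\<Lambda> ^ n = 1"
  then have "\<not> (n mod root_order \<Lambda> \<ge> 1)"
    using eq not_less_Least[of "n mod root_order \<Lambda>" "\<lambda>m. m \<ge> 1 \<and> \<Lambda> ^ m = 1"]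
      root_order_pos[OF assms] unfolding root_order_def[symmetric]
    by (metis mod_less_divisor)
  then show "root_order \<Lambda> dvd n"
    by (simp add: dvd_eq_mod_eq_0)
next
  assume "root_order \<Lambda> dvd n"
  then show "\<Lambda> ^ n = 1"
    using power_root_order[OF assms] by (auto simp: dvd_def power_mult)
qed

text \<open>
  If \<open>\<zeta>\<close> were closer to \<open>1\<close>, all of its powers would lie in the right half plane, although the
  powers of a nontrivial root of unity sum to zero.
\<close>

lemma root_of_unity_separation:
  fixes \<zeta> :: complex
  assumes "\<zeta> ^ M = 1" "\<zeta> \<noteq> 1" "M > 0"
  shows "cmod (\<zeta> - 1) \<ge> 1 / real M"
proof (rule ccontr)
  assume "\<not> ?thesis"
  then have lt: "real M * cmod (\<zeta> - 1) < 1"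
    using assms by (simp add: field_simps)
  have norm: "cmod \<zeta> = 1"
    using assms cmod_unity_root unity_rootsI by blast
  have "Re (\<zeta> ^ k) > 0" if "k < M" for k
  proof -
    have "\<zeta> ^ k - 1 = (\<zeta> - 1) * (\<Sum>i<k. \<zeta> ^ i)"
      by (simp add: power_diff_1_eq)
    then have "cmod (\<zeta> ^ k - 1) \<le> cmod (\<zeta> - 1) * (\<Sum>i<k. cmod (\<zeta> ^ i))"
      by (simp add: norm_mult mult_left_mono norm_sum)
    also have "\<dots> = real k * cmod (\<zeta> - 1)"
      by (simp add: norm_power norm)
    also have "\<dots> \<le> real M * cmod (\<zeta> - 1)"
      using that by (intro mult_right_mono) auto
    finally have "\<bar>Re (\<zeta> ^ k - 1)\<bar> < 1"
      using lt abs_Re_le_cmod[of "\<zeta> ^ k - 1"] by linarith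
    then show ?thesis
      by simp
  qed
  then have "Re (\<Sum>k<M. \<zeta> ^ k) > 0"
    using assms unfolding Re_sum by (intro sum_pos) auto
  moreover have "(\<Sum>k<M. \<zeta> ^ k) = 0"
    using power_diff_1_eq[of \<zeta> M] assms by simp
  ultimately show False
    by simp
qed

text \<open>The quotient of the two roots is a root of unity other than 1 whose exponent is the
  product of the two orders. Division by \<Lambda>0 preserves distances.\<close>

lemma unity_root_distance:
  assumes "\<Lambda> \<in> unity_roots" "\<Lambda>0 \<in> unity_roots" "\<Lambda> \<noteq> \<Lambda>0"
  shows "cmod (\<Lambda> - \<Lambda>0) \<ge> 1 / (real (root_order \<Lambda>0) * real (root_order \<Lambda>))"
proof -
  let ?M = "root_order \<Lambda>0 * root_order \<Lambda>"
  have nz: "\<Lambda>0 \<noteq> 0"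
    using assms unity_root_nonzero by blast
  have "(\<Lambda> / \<Lambda>0) ^ ?M = 1"
    using power_eq_1_iff_root_order_dvd[OF assms(1), of ?M] power_eq_1_iff_root_order_dvd[OF assms(2), of ?M]
    by (simp add: power_divide)
  then have "cmod (\<Lambda> / \<Lambda>0 - 1) \<ge> 1 / real ?M"
    using assms nz root_order_pos by (intro root_of_unity_separation) auto
  also have "cmod (\<Lambda> / \<Lambda>0 - 1) = cmod (\<Lambda> - \<Lambda>0) / cmod \<Lambda>0"
    using nz by (simp add: diff_divide_distrib flip: norm_divide)
  finally show ?thesis
    using cmod_unity_root[OF assms(2)] by simp
qed

section \<open>Disks tangent to the unit circle\<close>

text \<open>Concrete choices of the two disks demanded by the Gevrey class. Both centres have the
  form t l, with t = 1/2 here and t = 3/2 in \<open>outer_disk\<close>, and both radii are \<bar>t -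
  1\<bar> = 1/2, which allows a uniform treatment.\<close>

definition inner_disk :: "complex \<Rightarrow> complex set" where
  "inner_disk l = ball (l / 2) (1 / 2)"

definition outer_disk :: "complex \<Rightarrow> complex set" where
  "outer_disk l = ball (3 * l / 2) (1 / 2)"

text \<open>This is the law of cosines, with the angle between \<open>l\<close> and \<open>z\<close>
  expressed through the chord from \<open>l\<close> to \<open>z\<close>.\<close>

lemma cmod_of_real_times_diff:
  assumes "cmod l = 1" "cmod z = 1"
  shows "(cmod (of_real t * l - z))\<^sup>2 = (t - 1)\<^sup>2 + t * (cmod (z - l))\<^sup>2"
proof -
  have *: "(Re l)\<^sup>2 + (Im l)\<^sup>2 = 1" "(Re z)\<^sup>2 + (Im z)\<^sup>2 = 1"
    using assms by (simp_all flip: cmod_power2)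
  \<comment> \<open>The multiples of \<bar>l\<bar>^2 - 1 and \<bar>z\<bar>^2 - 1 turn the claim into
    a polynomial identity in the real and imaginary parts, free of side conditions.\<close>
  have "(cmod (of_real t * l - z))\<^sup>2 = (t - 1)\<^sup>2 + t * (cmod (z - l))\<^sup>2 +
      (t\<^sup>2 - t) * ((Re l)\<^sup>2 + (Im l)\<^sup>2 - 1) + (1 - t) * ((Re z)\<^sup>2 + (Im z)\<^sup>2 - 1)"
    unfolding cmod_power2 by (simp add: power2_eq_square algebra_simps)
  then show ?thesis
    by (simp add: *)
qed

text \<open>By the law of cosines, a common point \<open>z\<close> of the two circles satisfies t
  \<bar>z - l\<bar>^2 = 0.\<close>

lemma tangent_disk:
  assumes l: "cmod l = 1" and t: "t > 0" "t \<noteq> 1"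
  shows "disk_tangent_at l (ball (of_real t * l) \<bar>t - 1\<bar>)"
proof -
  have "z \<in> sphere (of_real t * l) \<bar>t - 1\<bar> \<inter> sphere 0 1 \<longleftrightarrow> z = l" for z
  proof
    assume "z \<in> sphere (of_real t * l) \<bar>t - 1\<bar> \<inter> sphere 0 1"
    then have z: "cmod (of_real t * l - z) = \<bar>t - 1\<bar>" "cmod z = 1"
      by (auto simp: dist_norm)
    then have "t * (cmod (z - l))\<^sup>2 = 0"
      using cmod_of_real_times_diff[OF l z(2), of t] by simp
    then show "z = l"
      using t by simp
  next
    assume "z = l"
    moreover have "of_real t * l - l = of_real (t - 1) * l"
      by (simp add: algebra_simps)
    ultimately show "z \<in> sphere (of_real t * l) \<bar>t - 1\<bar> \<inter> sphere 0 1"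
      using l by (simp add: dist_norm norm_mult del: of_real_diff)
  qed
  then have "sphere (of_real t * l) \<bar>t - 1\<bar> \<inter> sphere 0 1 = {l}"
    by blast
  then show ?thesis
    unfolding disk_tangent_at_def using t
    by (intro exI[of _ "of_real t * l"] exI[of _ "\<bar>t - 1\<bar>"] conjI refl) simp_all
qed

lemma
  assumes "cmod l = 1"
  shows inner_disk_tangent: "disk_tangent_at l (inner_disk l)"
    and outer_disk_tangent: "disk_tangent_at l (outer_disk l)"
  using tangent_disk[OF assms, of "1 / 2"] tangent_disk[OF assms, of "3 / 2"]
  by (simp_all add: inner_disk_def outer_disk_def)

lemma
  assumes "cmod l = 1"
  shows inner_disk_subset: "inner_disk l \<subseteq> {q. cmod q < 1}"
    and outer_disk_subset: "outer_disk l \<subseteq> {q. cmod q > 1}"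
proof -
  have "cmod q < 1" if "q \<in> inner_disk l" for q
    using that norm_triangle_ineq3[of "l / 2" q] assms
    by (simp add: inner_disk_def dist_norm norm_divide)
  moreover have "cmod q > 1" if "q \<in> outer_disk l" for q
    using that norm_triangle_ineq3[of "3 * l / 2" q] assms
    by (simp add: outer_disk_def dist_norm norm_divide norm_mult)
  ultimately show "inner_disk l \<subseteq> {q. cmod q < 1}" "outer_disk l \<subseteq> {q. cmod q > 1}"
    by auto
qed

text \<open>Let d be the distance from the centre t l of the disk to \<open>z\<close>. The law of
  cosines gives d^2 - 1/4 = t \<bar>z - l\<bar>^2, so d exceeds the radius 1/2 by an amount of
  second order in the chord, and \<bar>q - z\<bar> is at least this excess.\<close>

lemma tangent_disks_distance:
  assumes l: "cmod l = 1" and z: "cmod z = 1" and q: "q \<in> inner_disk l \<union> outer_disk l"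
  shows "cmod (q - l) < 1" and "cmod (q - z) \<ge> (cmod (z - l))\<^sup>2 / 4"
proof -
  obtain t :: real where t: "t = 1 / 2 \<or> t = 3 / 2" and q': "cmod (of_real t * l - q) < 1 / 2"
  proof (cases "q \<in> inner_disk l")
    case True
    then show ?thesis
      using that[of "1 / 2"] by (simp add: inner_disk_def dist_norm)
  next
    case False
    then show ?thesis
      using that[of "3 / 2"] q by (simp add: outer_disk_def dist_norm)
  qed
  have "cmod (of_real t * l - l) = 1 / 2"
  proof -
    have "of_real t * l - l = of_real (t - 1) * l"
      by (simp add: algebra_simps)
    then show ?thesis
      using l t by (auto simp: norm_mult simp del: of_real_diff)
  qed
  then show "cmod (q - l) < 1"
    using q' norm_triangle_ineq4[of "of_real t * l - l" "of_real t * l - q"] by simp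
  define d where "d = cmod (of_real t * l - z)"
  have d: "d\<^sup>2 = 1 / 4 + t * (cmod (z - l))\<^sup>2"
    unfolding d_def cmod_of_real_times_diff[OF l z] using t by (elim disjE; hypsubst; simp add: power2_eq_square)
  have "d \<le> t + 1"
    using norm_triangle_ineq4[of "of_real t * l" z] l z t by (auto simp: d_def norm_mult)
  moreover have "d \<ge> 1 / 2"
    by (rule power2_le_imp_le) (use d t in \<open>auto simp: d_def power2_eq_square\<close>)
  then have "t * (cmod (z - l))\<^sup>2 = (d - 1 / 2) * (d + 1 / 2)"
    using d by (simp add: power2_eq_square algebra_simps)
  ultimately have le: "t * (cmod (z - l))\<^sup>2 \<le> (d - 1 / 2) * (t + 3 / 2)"
    using \<open>d \<ge> 1 / 2\<close> by (simp add: mult_left_mono)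
  \<comment> \<open>The bound d + 1/2 \<le> t + 3/2 leaves the factor t / (t + 3/2), which is 1/4
    for the inner disk and 1/2 for the outer one.\<close>
  have "(cmod (z - l))\<^sup>2 / 4 \<le> d - 1 / 2"
  proof (cases "t = 1 / 2")
    case True
    show ?thesis
      using le unfolding True by simp
  next
    case False
    then have t': "t = 3 / 2"
      using t by blast
    have "(cmod (z - l))\<^sup>2 \<le> 2 * d - 1"
      using le unfolding t' by simp
    moreover have "(cmod (z - l))\<^sup>2 \<ge> 0"
      by simp
    ultimately show ?thesis
      by argo
  qed
  moreover have "cmod (q - z) \<ge> d - 1 / 2"
    using q' norm_triangle_ineq4[of "of_real t * l - q" "z - q"] norm_minus_commute[of q z]
    by (simp add: d_def)
  ultimately show "cmod (q - z) \<ge> (cmod (z - l))\<^sup>2 / 4"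
    by linarith
qed

section \<open>Sums and moments over the roots of unity\<close>

text \<open>There are at most m roots of order m, and the weight 1/m compensates for their number.
  Grouping by order leaves a geometric series.\<close>

lemma summable_on_unity_roots:
  fixes \<sigma> :: real
  assumes "0 \<le> \<sigma>" "\<sigma> < 1"
  shows "(\<lambda>\<Lambda>. \<sigma> ^ root_order \<Lambda> / real (root_order \<Lambda>)) summable_on unity_roots"
proof (rule nonneg_bdd_above_summable_on)
  let ?f = "\<lambda>\<Lambda>. \<sigma> ^ root_order \<Lambda> / real (root_order \<Lambda>)"
  have "sum ?f X \<le> (\<Sum>m. \<sigma> ^ m)" if X: "X \<subseteq> unity_roots" "finite X" for X
  proof -
    have "sum ?f X = (\<Sum>m\<in>root_order ` X. \<Sum>\<Lambda>\<in>{\<Lambda>\<in>X. root_order \<Lambda> = m}. ?f \<Lambda>)"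
      using X by (intro sum.group[symmetric]) auto
    also have "\<dots> \<le> (\<Sum>m\<in>root_order ` X. \<sigma> ^ m)"
    proof (rule sum_mono)
      fix m
      assume "m \<in> root_order ` X"
      then have m: "m > 0"
        using X root_order_pos by auto
      have "card {\<Lambda>\<in>X. root_order \<Lambda> = m} \<le> card {z::complex. z ^ m = 1}"
        using X m power_root_order by (intro card_mono finite_roots_unity) auto
      then have "card {\<Lambda>\<in>X. root_order \<Lambda> = m} \<le> m"
        using m by (simp add: card_roots_unity_eq)
      then have "real (card {\<Lambda>\<in>X. root_order \<Lambda> = m}) * (\<sigma> ^ m / real m) \<le> real m * (\<sigma> ^ m / real m)"
        using assms by (intro mult_right_mono) auto
      then show "(\<Sum>\<Lambda>\<in>{\<Lambda>\<in>X. root_order \<Lambda> = m}. ?f \<Lambda>) \<le> \<sigma> ^ m"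
        using m by simp
    qed
    also have "\<dots> \<le> (\<Sum>m. \<sigma> ^ m)"
      using assms X by (intro sum_le_suminf summable_geometric) auto
    finally show ?thesis .
  qed
  then show "bdd_above (sum ?f ` {X. X \<subseteq> unity_roots \<and> finite X})"
    by (intro bdd_aboveI) auto
qed (use assms in auto)

text \<open>The inequality \<open>x\<^sup>p / p! \<le> exp x\<close> at \<open>x = s m\<close>, where \<open>s\<close> is chosen so that \<open>r exp s = sqrt r\<close>.\<close>

lemma power_times_geometric_le:
  fixes r :: real
  assumes "0 < r" "r < 1"
  defines "s \<equiv> - ln r / 2"
  shows "real m ^ p * r ^ m \<le> fact p / s ^ p * sqrt r ^ m"
proof -
  have s: "s > 0"
    using assms by simp
  have "sum (\<lambda>n. (s * real m) ^ n /\<^sub>R fact n) {p} \<le> (\<Sum>n. (s * real m) ^ n /\<^sub>R fact n)"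
    using s by (intro sum_le_suminf summable_exp_generic) auto
  then have "(s * real m) ^ p / fact p \<le> exp (s * real m)"
    by (simp add: exp_def divide_inverse mult.commute)
  then have "real m ^ p \<le> fact p / s ^ p * exp (s * real m)"
    using s by (simp add: field_simps power_mult_distrib)
  then have "real m ^ p * r ^ m \<le> fact p / s ^ p * exp (s * real m) * r ^ m"
    using assms(1) by (intro mult_right_mono) auto
  moreover have "exp (s * real m) * r ^ m = sqrt r ^ m"
  proof -
    have "exp s * r = sqrt r"
    proof -
      have "exp s = 1 / sqrt r"
        using assms by (simp add: s_def exp_minus ln_sqrt[symmetric] exp_ln inverse_eq_divide)
      then show ?thesis
        using assms by (simp add: real_div_sqrt)
    qed
    moreover have "exp (s * real m) = exp s ^ m"
      by (simp add: exp_of_nat2_mult)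
    ultimately show ?thesis
      by (simp flip: power_mult_distrib)
  qed
  ultimately show ?thesis
    by (simp only: mult.assoc)
qed

text \<open>Half of the geometric decay is spent on absorbing the power of the order, the other half
  keeps the sum finite. The factor p! that this costs is the source of the Gevrey order 1.\<close>

lemma unity_root_moments:
  fixes r :: real
  assumes "0 < r" "r < 1"
  shows "(\<lambda>\<Lambda>. real (root_order \<Lambda>) ^ p * (r ^ root_order \<Lambda> / real (root_order \<Lambda>))) summable_on unity_roots"
    and "(\<Sum>\<^sub>\<infinity>\<Lambda>\<in>unity_roots. real (root_order \<Lambda>) ^ p * (r ^ root_order \<Lambda> / real (root_order \<Lambda>)))
      \<le> fact p / (- ln r / 2) ^ p * (\<Sum>\<^sub>\<infinity>\<Lambda>\<in>unity_roots. sqrt r ^ root_order \<Lambda> / real (root_order \<Lambda>))"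
proof -
  let ?g = "\<lambda>\<Lambda>. fact p / (- ln r / 2) ^ p * (sqrt r ^ root_order \<Lambda> / real (root_order \<Lambda>))"
  have g: "?g summable_on unity_roots"
    using assms by (intro summable_on_cmult_right summable_on_unity_roots) auto
  have le: "real (root_order \<Lambda>) ^ p * (r ^ root_order \<Lambda> / real (root_order \<Lambda>)) \<le> ?g \<Lambda>" for \<Lambda>
    using divide_right_mono[OF power_times_geometric_le[OF assms, of "root_order \<Lambda>" p], of "root_order \<Lambda>"]
    by simp
  show s: "(\<lambda>\<Lambda>. real (root_order \<Lambda>) ^ p * (r ^ root_order \<Lambda> / real (root_order \<Lambda>))) summable_on unity_roots"
    by (rule summable_on_comparison_test[OF g le]) (use assms in auto)
  show "(\<Sum>\<^sub>\<infinity>\<Lambda>\<in>unity_roots. real (root_order \<Lambda>) ^ p * (r ^ root_order \<Lambda> / real (root_order \<Lambda>)))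
      \<le> fact p / (- ln r / 2) ^ p * (\<Sum>\<^sub>\<infinity>\<Lambda>\<in>unity_roots. sqrt r ^ root_order \<Lambda> / real (root_order \<Lambda>))"
    using infsum_mono[OF s g le]
    by (subst (asm) infsum_cmult_right) (use assms summable_on_unity_roots[of "sqrt r"] in auto)
qed

section \<open>Gevrey expansions of Borel-Wolff-Denjoy series\<close>

text \<open>Two expansions of one function may come with different disks. Every admissible inner
  disk has its centre on the radius through \<open>l\<close>, so all of them contain the end of that
  radius and comparisons can be made there.\<close>

lemma tangent_disk_contains_radius:
  assumes l: "cmod l = 1" and \<Delta>: "disk_tangent_at l \<Delta>" "\<Delta> \<subseteq> {q. cmod q < 1}"
  shows "eventually (\<lambda>t. of_real (1 - t) * l \<in> \<Delta>) (at_right 0)"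
proof -
  obtain p \<rho> where \<rho>: "\<rho> > 0" and ball: "\<Delta> = ball p \<rho>" and lp: "cmod (l - p) = \<rho>"
  proof -
    obtain p \<rho> where *: "\<rho> > 0" "\<Delta> = ball p \<rho>" "sphere p \<rho> \<inter> sphere 0 1 = {l}"
      using \<Delta>(1) by (auto simp: disk_tangent_at_def)
    then have "l \<in> sphere p \<rho>"
      by blast
    then show ?thesis
      using * that by (simp add: dist_norm norm_minus_commute)
  qed
  have "ball p \<rho> \<subseteq> ball 0 1"
    using \<Delta>(2) ball by auto
  then have "cmod p + \<rho> \<le> 1"
    using \<rho> by (auto simp: ball_subset_ball_iff)
  moreover have "1 \<le> cmod p + \<rho>"
    using norm_triangle_ineq[of p "l - p"] l lp by simp
  ultimately have sum: "cmod p + \<rho> = 1"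
    by simp
  \<comment> \<open>Equality in the triangle inequality forces \<open>p\<close> and
    \<open>l - p\<close> to point in the same direction, so \<open>p\<close> is a nonnegative real
    multiple of \<open>l\<close>.\<close>
  then have "cmod (p + (l - p)) = cmod p + cmod (l - p)"
    using l lp by simp
  then have "cmod p *\<^sub>R (l - p) = cmod (l - p) *\<^sub>R p"
    by (simp only: norm_triangle_eq)
  then have "p = cmod p *\<^sub>R l"
    using sum lp by (simp add: scaleR_right_diff_distrib algebra_simps flip: scaleR_add_left)
  then have p: "p = of_real (1 - \<rho>) * l"
    using sum by (simp add: scaleR_conv_of_real flip: sum)
  have "eventually (\<lambda>t. t < \<rho>) (at_right 0)" "eventually (\<lambda>t. 0 < t) (at_right (0::real))"
    using \<rho> by (auto simp: eventually_at_right_less intro: order_tendstoD tendsto_ident_at)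
  then show ?thesis
  proof eventually_elim
    case (elim t)
    have "p - of_real (1 - t) * l = of_real (t - \<rho>) * l"
      by (simp add: p algebra_simps)
    then have "cmod (p - of_real (1 - t) * l) = \<bar>t - \<rho>\<bar>"
      using l by (simp add: norm_mult del: of_real_diff)
    then show ?case
      using elim by (simp add: ball dist_norm)
  qed
qed

text \<open>Along the radius q = (1 - t) l one has \<bar>q - l\<bar> = t. If the coefficients agree
  below n, the partial sums of length n + 1 differ by t^n times the norm of the difference of the
  n-th coefficients, while both approximate \<open>f\<close> up to O(t^(n+1)). Division by t^n and t
  \<longlonglongrightarrow> 0 finish the induction.\<close>

lemma (in complex_normed) gevrey1_expansion_unique:
  assumes l: "cmod l = 1" and "gevrey1_expansion l B f a" "gevrey1_expansion l B f b"
  shows "a = b"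
proof -
  let ?S = "\<lambda>a N q. \<Sum>n<N. smul B ((q - l) ^ n) (fps_nth a n)"
  \<comment> \<open>The Gevrey constants of order \<open>N\<close> are merged into one constant
    \<open>C\<close> depending on \<open>N\<close>.\<close>
  have bound: "(\<forall>n. fps_nth a n \<in> vecs B) \<and> (\<forall>N. \<exists>C. eventually (\<lambda>t.
      let q = of_real (1 - t) * l in f q \<in> vecs B \<and> nrm B (f q - ?S a N q) \<le> C * t ^ N) (at_right 0))"
    if a: "gevrey1_expansion l B f a" for a
  proof (intro conjI allI)
    show "fps_nth a n \<in> vecs B" for n
      using a by (simp add: gevrey1_expansion_def)
    fix N
    obtain \<Delta>m \<Delta>p c0 c1 where \<Delta>: "\<Delta>m \<subseteq> {q. cmod q < 1}" "disk_tangent_at l \<Delta>m"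
      and hol: "vec_holomorphic_on B f (\<Delta>m \<union> \<Delta>p)"
      and le: "\<And>q. q \<in> \<Delta>m \<union> \<Delta>p \<Longrightarrow>
        nrm B (f q - ?S a N q) \<le> c0 * c1 ^ N * Gamma (1 + real N) * cmod (q - l) ^ N"
      using a unfolding gevrey1_expansion_def by blast
    have "eventually (\<lambda>t. 0 < t) (at_right (0::real))"
      by (simp add: eventually_at_right_less)
    then have "eventually (\<lambda>t. let q = of_real (1 - t) * l in f q \<in> vecs B \<and>
        nrm B (f q - ?S a N q) \<le> c0 * c1 ^ N * Gamma (1 + real N) * t ^ N) (at_right 0)"
      using tangent_disk_contains_radius[OF l \<Delta>(2,1)]
    proof eventually_elim
      case (elim t)
      have "of_real (1 - t) * l - l = of_real (- t) * l"
        by (simp add: algebra_simps)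
      then have "cmod (of_real (1 - t) * l - l) = t"
        using l elim by (simp add: norm_mult del: of_real_minus of_real_diff)
      then show ?case
        using le[of "of_real (1 - t) * l"] hol elim by (simp add: Let_def vec_holomorphic_on_def)
    qed
    then show "\<exists>C. eventually (\<lambda>t. let q = of_real (1 - t) * l in f q \<in> vecs B \<and>
        nrm B (f q - ?S a N q) \<le> C * t ^ N) (at_right 0)"
      by blast
  qed
  have mem: "fps_nth a n \<in> vecs B" "fps_nth b n \<in> vecs B" for n
    using bound[OF assms(2)] bound[OF assms(3)] by simp_all
  have "fps_nth a n = fps_nth b n" for n
  proof (induction n rule: less_induct)
    case (less n)
    obtain C1 C2 where C:
      "eventually (\<lambda>t. let q = of_real (1 - t) * l in f q \<in> vecs B \<and>
          nrm B (f q - ?S a (Suc n) q) \<le> C1 * t ^ Suc n) (at_right 0)"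
      "eventually (\<lambda>t. let q = of_real (1 - t) * l in f q \<in> vecs B \<and>
          nrm B (f q - ?S b (Suc n) q) \<le> C2 * t ^ Suc n) (at_right 0)"
      using bound[OF assms(2), THEN conjunct2, THEN spec, of "Suc n"]
        bound[OF assms(3), THEN conjunct2, THEN spec, of "Suc n"] by (elim exE)
    let ?d = "fps_nth a n - fps_nth b n"
    have "eventually (\<lambda>t. 0 < t) (at_right (0::real))"
      by (simp add: eventually_at_right_less)
    then have "eventually (\<lambda>t. nrm B ?d \<le> (C1 + C2) * t) (at_right 0)"
      using C
    proof eventually_elim
      case (elim t)
      define q where "q = of_real (1 - t) * l"
      have S: "?S a N q \<in> vecs B" "?S b N q \<in> vecs B" for N
        by (intro sum_mem smul_mem mem)+
      have "of_real (1 - t) * l - l = of_real (- t) * l"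
        by (simp add: algebra_simps)
      then have q: "cmod (q - l) = t"
        using l elim by (simp add: q_def norm_mult del: of_real_minus of_real_diff)
      have f: "f q \<in> vecs B" "nrm B (f q - ?S a (Suc n) q) \<le> C1 * t ^ Suc n"
        "nrm B (f q - ?S b (Suc n) q) \<le> C2 * t ^ Suc n"
        using elim unfolding Let_def q_def[symmetric] by blast+
      have "?S a n q = ?S b n q"
        using less.IH by (intro sum.cong) auto
      then have "?S a (Suc n) q - ?S b (Suc n) q = smul B ((q - l) ^ n) ?d"
        by (simp add: scale_right_diff_distrib)
      then have "t ^ n * nrm B ?d = nrm B (?S a (Suc n) q - ?S b (Suc n) q)"
        using mem diff_mem q by (simp add: nrm_smul norm_power)
      also have "\<dots> \<le> nrm B (?S a (Suc n) q - f q) + nrm B (f q - ?S b (Suc n) q)"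
        by (intro nrm_triangle_diff S f)
      also have "\<dots> \<le> C1 * t ^ Suc n + C2 * t ^ Suc n"
        unfolding nrm_minus_commute[OF S(1) f(1)] by (intro add_mono f)
      also have "\<dots> = t ^ n * ((C1 + C2) * t)"
        by (simp add: algebra_simps)
      finally show ?case
        using elim by simp
    qed
    moreover have "((\<lambda>t. (C1 + C2) * t) \<longlongrightarrow> (C1 + C2) * 0) (at_right 0)"
      by (intro tendsto_intros)
    ultimately have "nrm B ?d \<le> (C1 + C2) * 0"
      by (intro tendsto_lowerbound[where F = "at_right (0::real)"]) simp_all
    then show ?case
      using nrm_nonneg[of ?d] nrm_eq_0[of ?d] diff_mem[OF mem] by simp
  qed
  then show ?thesis
    by (simp add: fps_eq_iff)
qed

lemma (in complex_normed) asymp_expansion_eqI: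
  assumes "cmod l = 1" "gevrey1_expansion l B f a"
  shows "asymp_expansion l B f = a"
  using assms gevrey1_expansion_unique unfolding asymp_expansion_def by (intro the_equality) auto

lemma vec_holomorphic_on_cong:
  assumes f: "vec_holomorphic_on B f S" and fg: "\<And>q. q \<in> S \<Longrightarrow> f q = g q"
  shows "vec_holomorphic_on B g S"
  unfolding vec_holomorphic_on_def
proof
  fix z
  assume z: "z \<in> S"
  obtain D where "f z \<in> vecs B"
    and D: "norm_tendsto B (\<lambda>w. smul B (1 / (w - z)) (f w - f z)) D (at z within S)"
    using f z unfolding vec_holomorphic_on_def by blast
  have ev: "eventually (\<lambda>w. nrm B (smul B (1 / (w - z)) (f w - f z) - D) =
      nrm B (smul B (1 / (w - z)) (g w - g z) - D)) (at z within S)"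
    using fg z by (auto simp: eventually_at_filter)
  then have "norm_tendsto B (\<lambda>w. smul B (1 / (w - z)) (g w - g z)) D (at z within S)"
    using D tendsto_cong[OF ev] unfolding norm_tendsto_def by simp
  then show "g z \<in> vecs B \<and> (\<exists>D. norm_tendsto B (\<lambda>w. smul B (1 / (w - z)) (g w - g z)) D (at z within S))"
    using \<open>f z \<in> vecs B\<close> fg z by auto
qed

text \<open>The disks of an expansion avoid the unit circle, so agreement off the circle is enough.
  This matters because the series represents the solution of the cohomological equation only
  there.\<close>

lemma gevrey1_expansion_cong:
  assumes eq: "\<And>q. cmod q \<noteq> 1 \<Longrightarrow> f q = g q" and f: "gevrey1_expansion l B f a"
  shows "gevrey1_expansion l B g a"
proof -
  obtain \<Delta>m \<Delta>p c0 c1 where *: "\<forall>n. fps_nth a n \<in> vecs B"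
    "\<Delta>m \<subseteq> {q. cmod q < 1}" "disk_tangent_at l \<Delta>m"
    "\<Delta>p \<subseteq> {q. cmod q > 1}" "disk_tangent_at l \<Delta>p"
    "vec_holomorphic_on B f (\<Delta>m \<union> \<Delta>p)" "0 < c0" "0 < c1"
    "\<forall>N. \<forall>q\<in>\<Delta>m \<union> \<Delta>p. nrm B (f q - (\<Sum>n<N. smul B ((q - l) ^ n) (fps_nth a n)))
        \<le> c0 * c1 ^ N * Gamma (1 + real N) * cmod (q - l) ^ N"
    using f unfolding gevrey1_expansion_def by blast
  have fg: "f q = g q" if "q \<in> \<Delta>m \<union> \<Delta>p" for q
  proof -
    have "cmod q < 1 \<or> cmod q > 1"
      using that *(2,4) by blast
    then show ?thesis
      using eq[of q] by linarith
  qed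
  have "vec_holomorphic_on B g (\<Delta>m \<union> \<Delta>p)"
    using *(6) fg vec_holomorphic_on_cong[of B f "\<Delta>m \<union> \<Delta>p" g] by blast
  moreover have "\<forall>N. \<forall>q\<in>\<Delta>m \<union> \<Delta>p. nrm B (g q - (\<Sum>n<N. smul B ((q - l) ^ n) (fps_nth a n)))
        \<le> c0 * c1 ^ N * Gamma (1 + real N) * cmod (q - l) ^ N"
    using *(9) by (simp add: fg)
  ultimately show ?thesis
    unfolding gevrey1_expansion_def using *(1-5,7,8) by blast
qed

section \<open>Kernels of the series, their Taylor remainders and derivatives\<close>

definition bwd_weight :: "real \<Rightarrow> real \<Rightarrow> complex \<Rightarrow> real" where
  "bwd_weight c r \<Lambda> = c * (r ^ root_order \<Lambda> / real (root_order \<Lambda>))"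

locale bwd_family = complex_banach B for B :: "'b::ab_group_add cspace" +
  fixes a :: "complex \<Rightarrow> 'b" and r c :: real and l :: complex
  assumes r: "0 < r" "r < 1" and c: "c > 0" and l: "l \<in> unity_roots"
    and mem: "\<Lambda> \<in> unity_roots \<Longrightarrow> a \<Lambda> \<in> vecs B"
    and le: "\<Lambda> \<in> unity_roots \<Longrightarrow> nrm B (a \<Lambda>) \<le> bwd_weight c r \<Lambda>"

sublocale bwd_family \<subseteq> weighted_family B a "bwd_weight c r" unity_roots
  using mem le by unfold_locales

context bwd_family
begin

definition disks :: "complex set" where
  "disks = inner_disk l \<union> outer_disk l"

definition kernel :: "complex \<Rightarrow> complex \<Rightarrow> complex" where
  "kernel q \<Lambda> = (q - l) * (1 / (q - \<Lambda>))"

text \<open>These are the Taylor coefficients of \<open>kernel q \<Lambda>\<close> in powers of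
  \<open>q - l\<close>. For \<Lambda> \<noteq> l the numerator \<open>q - l\<close> removes the
  constant term of the geometric series.\<close>

definition kernel_coeff :: "nat \<Rightarrow> complex \<Rightarrow> complex" where
  "kernel_coeff n \<Lambda> =
     (if \<Lambda> = l then if n = 0 then 1 else 0 else if n = 0 then 0 else - (1 / (\<Lambda> - l) ^ n))"

lemma cmod_l: "cmod l = 1"
  using l cmod_unity_root by blast

lemma disks_cmod: "q \<in> disks \<Longrightarrow> cmod q \<noteq> 1"
  using inner_disk_subset[OF cmod_l] outer_disk_subset[OF cmod_l] by (force simp: disks_def)

text \<open>The reciprocal of the lower bound for \<bar>\<Lambda> - l\<bar>. All estimates of
  kernels below are made in powers of it, so that the weighted sums become moments.\<close>

definition height :: "complex \<Rightarrow> real" where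
  "height \<Lambda> = real (root_order l) * real (root_order \<Lambda>)"

lemma height_ge_1: "\<Lambda> \<in> unity_roots \<Longrightarrow> height \<Lambda> \<ge> 1"
  using mult_mono[of 1 "real (root_order l)" 1 "real (root_order \<Lambda>)"] root_order_pos[of l]
    root_order_pos[of \<Lambda>] l by (simp add: height_def Suc_le_eq)

text \<open>The first bound is the separation of roots of unity. The second combines it with the
  quadratic departure of the tangent disks from the circle, hence the square.\<close>

lemma inverse_distance_le:
  assumes \<Lambda>: "\<Lambda> \<in> unity_roots" "\<Lambda> \<noteq> l"
  shows "cmod (1 / (\<Lambda> - l)) \<le> height \<Lambda>"
    and "q \<in> disks \<Longrightarrow> cmod (1 / (q - \<Lambda>)) \<le> 4 * height \<Lambda> ^ 2"
proof -
  have h: "height \<Lambda> > 0"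
    using height_ge_1[OF \<Lambda>(1)] by simp
  have d: "1 / height \<Lambda> \<le> cmod (\<Lambda> - l)"
    using unity_root_distance[OF \<Lambda>(1) l \<Lambda>(2)] by (simp add: height_def)
  then show "cmod (1 / (\<Lambda> - l)) \<le> height \<Lambda>"
    using h \<Lambda>(2) by (simp add: norm_divide field_simps)
  assume q: "q \<in> disks"
  have "(1 / height \<Lambda>)\<^sup>2 \<le> (cmod (\<Lambda> - l))\<^sup>2"
    using d h by (intro power_mono) auto
  then have "1 / (4 * height \<Lambda> ^ 2) \<le> cmod (q - \<Lambda>)"
    using tangent_disks_distance(2)[OF cmod_l, of \<Lambda> q] cmod_unity_root[OF \<Lambda>(1)] q
    by (simp add: disks_def power_divide)
  moreover have "q \<noteq> \<Lambda>"
    using disks_cmod[OF q] cmod_unity_root[OF \<Lambda>(1)] by blast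
  ultimately show "cmod (1 / (q - \<Lambda>)) \<le> 4 * height \<Lambda> ^ 2"
    using h by (simp add: norm_divide field_simps)
qed

lemma
  fixes C :: real
  shows height_summable:
      "(\<lambda>\<Lambda>. C * height \<Lambda> ^ p * bwd_weight c r \<Lambda>) summable_on unity_roots"
    and height_moment: "0 \<le> C \<Longrightarrow>
      (\<Sum>\<^sub>\<infinity>\<Lambda>\<in>unity_roots. C * height \<Lambda> ^ p * bwd_weight c r \<Lambda>)
      \<le> C * real (root_order l) ^ p * c * (fact p / (- ln r / 2) ^ p *
          (\<Sum>\<^sub>\<infinity>\<Lambda>\<in>unity_roots. sqrt r ^ root_order \<Lambda> / real (root_order \<Lambda>)))"
proof -
  let ?g = "\<lambda>\<Lambda>. real (root_order \<Lambda>) ^ p * (r ^ root_order \<Lambda> / real (root_order \<Lambda>))"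
  let ?K = "C * real (root_order l) ^ p * c"
  have eq: "C * height \<Lambda> ^ p * bwd_weight c r \<Lambda> = ?K * ?g \<Lambda>" for \<Lambda>
    by (simp add: bwd_weight_def height_def power_mult_distrib)
  have g: "?g summable_on unity_roots"
    using r by (rule unity_root_moments)
  show "(\<lambda>\<Lambda>. C * height \<Lambda> ^ p * bwd_weight c r \<Lambda>) summable_on unity_roots"
    unfolding eq using g by (rule summable_on_cmult_right)
  assume "0 \<le> C"
  then have "0 \<le> ?K"
    using c by simp
  then show "(\<Sum>\<^sub>\<infinity>\<Lambda>\<in>unity_roots. C * height \<Lambda> ^ p * bwd_weight c r \<Lambda>)
      \<le> ?K * (fact p / (- ln r / 2) ^ p *
          (\<Sum>\<^sub>\<infinity>\<Lambda>\<in>unity_roots. sqrt r ^ root_order \<Lambda> / real (root_order \<Lambda>)))"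
    unfolding eq infsum_cmult_right[OF g] using unity_root_moments(2)[OF r, of p]
    by (intro mult_left_mono)
qed

lemma wsummable_height:
  assumes "\<And>\<Lambda>. \<Lambda> \<in> unity_roots \<Longrightarrow> cmod (k \<Lambda>) \<le> C * height \<Lambda> ^ p"
  shows "wsummable k"
  using height_summable assms by (rule wsummableI)

text \<open>This is the finite geometric series with its exact remainder. Each step rests on 1/(q -
  \<Lambda>) + 1/(\<Lambda> - l) = (q - l) / ((\<Lambda> - l)(q - \<Lambda>)). At least one term is
  taken off, since the formula has only \<open>M\<close> factors 1/(\<Lambda> - l) for
  \<open>Suc M\<close> terms.\<close>

lemma kernel_geometric:
  assumes "\<Lambda> \<noteq> l" "q \<noteq> \<Lambda>"
  shows "kernel q \<Lambda> - (\<Sum>n<Suc M. (q - l) ^ n * kernel_coeff n \<Lambda>)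
    = (q - l) ^ Suc M * ((1 / (\<Lambda> - l)) ^ M * (1 / (q - \<Lambda>)))"
proof (induction M)
  case 0
  then show ?case
    using assms by (simp add: kernel_def kernel_coeff_def)
next
  case (Suc M)
  have nz: "\<Lambda> - l \<noteq> 0" "q - \<Lambda> \<noteq> 0"
    using assms by auto
  have "kernel q \<Lambda> - (\<Sum>n<Suc (Suc M). (q - l) ^ n * kernel_coeff n \<Lambda>)
      = (q - l) ^ Suc M * ((1 / (\<Lambda> - l)) ^ M * (1 / (q - \<Lambda>)))
        + (q - l) ^ Suc M * (1 / (\<Lambda> - l)) ^ Suc M"
    unfolding sum.lessThan_Suc[of _ "Suc M"] Suc.IH diff_diff_eq[symmetric]
    using assms by (simp add: kernel_coeff_def power_divide)
  also have "\<dots> = (q - l) ^ Suc M * (1 / (\<Lambda> - l)) ^ M * (1 / (q - \<Lambda>) + 1 / (\<Lambda> - l))"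
    by (simp add: algebra_simps)
  also have "1 / (q - \<Lambda>) + 1 / (\<Lambda> - l) = (q - l) * (1 / (\<Lambda> - l)) * (1 / (q - \<Lambda>))"
    using nz by (simp add: field_simps)
  finally show ?case
    by (simp add: mult_ac)
qed

text \<open>The factor 1/(q - \<Lambda>) costs 4 times the squared height, each factor 1/(\<Lambda>
  - l) one height. For N > 0 there are only N - 1 of the latter. The exponent is rounded up to N + 2
  so that one bound covers N = 0 and \<Lambda> = l as well.\<close>

lemma kernel_remainder:
  assumes \<Lambda>: "\<Lambda> \<in> unity_roots" and q: "q \<in> disks"
  shows "cmod (kernel q \<Lambda> - (\<Sum>n<N. (q - l) ^ n * kernel_coeff n \<Lambda>))
    \<le> 4 * cmod (q - l) ^ N * height \<Lambda> ^ (N + 2)"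
proof -
  have nz: "q \<noteq> \<Lambda>" "q \<noteq> l"
    using disks_cmod[OF q] cmod_l cmod_unity_root[OF \<Lambda>] by auto
  have h: "height \<Lambda> \<ge> 1"
    using height_ge_1[OF \<Lambda>] .
  have ql: "cmod (q - l) < 1"
    using tangent_disks_distance(1)[OF cmod_l cmod_l] q by (simp add: disks_def)
  show ?thesis
  proof (cases "\<Lambda> = l")
    case True
    \<comment> \<open>The kernel at \<Lambda> = l is the constant 1, so the remainder is 1 for the
      empty partial sum and 0 from the first term on.\<close>
    have "(\<Sum>n<N. (q - l) ^ n * kernel_coeff n \<Lambda>) = (\<Sum>n<N. if n = 0 then 1 else 0)"
      using True by (intro sum.cong) (auto simp: kernel_coeff_def)
    then have "cmod (kernel q \<Lambda> - (\<Sum>n<N. (q - l) ^ n * kernel_coeff n \<Lambda>)) = (if N = 0 then 1 else 0)"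
      using True nz by (simp add: kernel_def)
    also have "\<dots> \<le> 4 * cmod (q - l) ^ N * height \<Lambda> ^ (N + 2)"
      using h one_le_power[OF h, of 2] by (auto simp: power2_eq_square)
    finally show ?thesis .
  next
    case False
    note d = inverse_distance_le(1)[OF \<Lambda> False] and e = inverse_distance_le(2)[OF \<Lambda> False q]
    show ?thesis
    proof (cases N)
      case 0
      have "cmod (kernel q \<Lambda>) = cmod (q - l) * cmod (1 / (q - \<Lambda>))"
        unfolding kernel_def norm_mult ..
      also have "\<dots> \<le> 1 * (4 * height \<Lambda> ^ 2)"
        using ql e by (intro mult_mono) auto
      finally show ?thesis
        using 0 by (simp add: power2_eq_square)
    next
      case (Suc M)
      have "cmod (kernel q \<Lambda> - (\<Sum>n<N. (q - l) ^ n * kernel_coeff n \<Lambda>))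
          = cmod (q - l) ^ N * (cmod (1 / (\<Lambda> - l)) ^ M * cmod (1 / (q - \<Lambda>)))"
        unfolding Suc kernel_geometric[OF False nz(1)] norm_mult norm_power ..
      also have "\<dots> \<le> cmod (q - l) ^ N * (height \<Lambda> ^ M * (4 * height \<Lambda> ^ 2))"
        using d e h by (intro mult_left_mono mult_mono power_mono) auto
      also have "\<dots> = 4 * cmod (q - l) ^ N * height \<Lambda> ^ (M + 2)"
        by (simp add: power_add power2_eq_square)
      also have "\<dots> \<le> 4 * cmod (q - l) ^ N * height \<Lambda> ^ (N + 2)"
        using h Suc by (intro mult_left_mono power_increasing) auto
      finally show ?thesis .
    qed
  qed
qed

text \<open>The kernel is its own remainder of order 0.\<close>

lemma wsummable_kernel: "q \<in> disks \<Longrightarrow> wsummable (kernel q)"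
  using kernel_remainder[of _ q 0] by (intro wsummable_height[of _ 4 2]) (simp add: power2_eq_square)

lemma wsummable_kernel_coeff: "wsummable (kernel_coeff n)"
proof (rule wsummable_height)
  fix \<Lambda>
  assume \<Lambda>: "\<Lambda> \<in> unity_roots"
  then show "cmod (kernel_coeff n \<Lambda>) \<le> 1 * height \<Lambda> ^ n"
    using inverse_distance_le(1)[OF \<Lambda>] height_ge_1[OF \<Lambda>] power_mono[of "cmod (1 / (\<Lambda> - l))" "height \<Lambda>" n]
    by (auto simp: kernel_coeff_def norm_power norm_divide power_divide)
qed

text \<open>Off the unit circle 1/(q - \<Lambda>) is bounded uniformly in \<Lambda>, so the zeroth
  moment suffices. This gives convergence of the series on both components, not only on the tangent
  disks.\<close>

lemma wsummable_inverse_diff: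
  assumes q: "cmod q \<noteq> 1"
  shows "wsummable (\<lambda>\<Lambda>. 1 / (q - \<Lambda>))"
proof (rule wsummable_height[of _ "1 / \<bar>cmod q - 1\<bar>" 0])
  fix \<Lambda>
  assume "\<Lambda> \<in> unity_roots"
  then have "\<bar>cmod q - 1\<bar> \<le> cmod (q - \<Lambda>)"
    using norm_triangle_ineq3[of q \<Lambda>] cmod_unity_root[of \<Lambda>] by simp
  then show "cmod (1 / (q - \<Lambda>)) \<le> 1 / \<bar>cmod q - 1\<bar> * height \<Lambda> ^ 0"
    using q by (simp add: norm_divide frac_le)
qed

lemma smul_bwd_series:
  assumes q: "q \<in> disks"
  shows "smul B (q - l) (bwd_series B a q) = wsum (kernel q)"
  using wsum_cmult[OF wsummable_inverse_diff[OF disks_cmod[OF q]], of "q - l"]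
  by (simp add: wsum_def bwd_series_def kernel_def)

lemma bwd_series_tendsto:
  assumes "cmod q \<noteq> 1"
  shows "norm_tendsto B (sum (\<lambda>\<Lambda>. smul B (1 / (q - \<Lambda>)) (a \<Lambda>))) (bwd_series B a q)
    (finite_subsets_at_top unity_roots)"
  using wsum_tendsto[OF wsummable_inverse_diff[OF assms]] by (simp add: wsum_def bwd_series_def)

text \<open>\<open>kernel_coeff 0\<close> is the indicator of \<open>l\<close>, so every partial sum
  over a finite set containing \<open>l\<close> already equals \<open>a l\<close>.\<close>

lemma wsum_kernel_coeff_0: "wsum (kernel_coeff 0) = a l"
proof -
  let ?f = "\<lambda>\<Lambda>. smul B (kernel_coeff 0 \<Lambda>) (a \<Lambda>)"
  have "eventually (\<lambda>X. nrm B (sum ?f X - a l) = 0) (finite_subsets_at_top unity_roots)"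
    unfolding eventually_finite_subsets_at_top
  proof (intro exI[of _ "{l}"] conjI allI impI)
    fix X
    assume X: "finite X \<and> {l} \<subseteq> X \<and> X \<subseteq> unity_roots"
    have "sum ?f X = (\<Sum>\<Lambda>\<in>X. if \<Lambda> = l then a l else 0)"
      by (intro sum.cong) (auto simp: kernel_coeff_def)
    then show "nrm B (sum ?f X - a l) = 0"
      using X by simp
  qed (use l in auto)
  then have "norm_tendsto B (sum ?f) (a l) (finite_subsets_at_top unity_roots)"
    using mem[OF l] by (simp add: norm_tendsto_def tendsto_eventually)
  then show ?thesis
    unfolding wsum_def using mem smul_mem by (intro vec_infsum_eqI) auto
qed

text \<open>The derivative of the kernel is (l - \<Lambda>)/(z - \<Lambda>)^2, and the error is
  exactly (l - \<Lambda>)(z - v)/((v - \<Lambda>)(z - \<Lambda>)^2). With \<bar>l - \<Lambda>\<bar>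
  \<le> 2 and three inverse distances of size 4 height^2, the constant is 2 * 4^3 = 128.\<close>

lemma kernel_difference_quotient:
  assumes \<Lambda>: "\<Lambda> \<in> unity_roots" and z: "z \<in> disks" and v: "v \<in> disks" "v \<noteq> z"
  shows "cmod (1 / (v - z) * (kernel v \<Lambda> - kernel z \<Lambda>) - (l - \<Lambda>) * (1 / (z - \<Lambda>)) ^ 2)
    \<le> 128 * cmod (v - z) * height \<Lambda> ^ 6"
proof (cases "\<Lambda> = l")
  case True
  then have "kernel v \<Lambda> = kernel z \<Lambda>"
    using disks_cmod z v cmod_l by (auto simp: kernel_def)
  then show ?thesis
    using True height_ge_1[OF \<Lambda>] by simp
next
  case False
  have nz: "v - \<Lambda> \<noteq> 0" "z - \<Lambda> \<noteq> 0" "v - z \<noteq> 0"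
    using disks_cmod[OF z] disks_cmod[OF v(1)] cmod_unity_root[OF \<Lambda>] v(2) by auto
  have "1 / (v - z) * (kernel v \<Lambda> - kernel z \<Lambda>) = (l - \<Lambda>) * (1 / (v - \<Lambda>)) * (1 / (z - \<Lambda>))"
    using nz unfolding kernel_def by (simp add: divide_simps) (simp add: algebra_simps)
  then have "1 / (v - z) * (kernel v \<Lambda> - kernel z \<Lambda>) - (l - \<Lambda>) * (1 / (z - \<Lambda>)) ^ 2
      = (l - \<Lambda>) * (1 / (z - \<Lambda>)) * (1 / (v - \<Lambda>) - 1 / (z - \<Lambda>))"
    by (simp add: algebra_simps power2_eq_square)
  also have "1 / (v - \<Lambda>) - 1 / (z - \<Lambda>) = (z - v) * (1 / (v - \<Lambda>)) * (1 / (z - \<Lambda>))"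
    using nz by (simp add: field_simps)
  finally have "cmod (1 / (v - z) * (kernel v \<Lambda> - kernel z \<Lambda>) - (l - \<Lambda>) * (1 / (z - \<Lambda>)) ^ 2)
      = cmod (l - \<Lambda>) * cmod (z - v) * (cmod (1 / (z - \<Lambda>)) * (cmod (1 / (v - \<Lambda>)) * cmod (1 / (z - \<Lambda>))))"
    by (simp only: norm_mult mult_ac)
  also have "\<dots> \<le> 2 * cmod (z - v) * (4 * height \<Lambda> ^ 2 * (4 * height \<Lambda> ^ 2 * (4 * height \<Lambda> ^ 2)))"
    using inverse_distance_le(2)[OF \<Lambda> False z] inverse_distance_le(2)[OF \<Lambda> False v(1)]
      norm_triangle_ineq4[of l \<Lambda>] cmod_l cmod_unity_root[OF \<Lambda>]
    by (intro mult_mono) auto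
  also have "\<dots> = 128 * cmod (v - z) * height \<Lambda> ^ 6"
    by (simp add: norm_minus_commute power2_eq_square eval_nat_numeral)
  finally show ?thesis .
qed

text \<open>The series is differentiated term by term. The errors of the difference quotients are
  linear in \<bar>v - z\<bar> with a factor of finite sixth moment, so they sum to a multiple of
  \<bar>v - z\<bar>.\<close>

lemma vec_holomorphic_wsum_kernel: "vec_holomorphic_on B (\<lambda>q. wsum (kernel q)) disks"
  unfolding vec_holomorphic_on_def
proof (intro ballI conjI exI)
  fix z
  assume z: "z \<in> disks"
  show "wsum (kernel z) \<in> vecs B"
    using wsummable_kernel[OF z] by (rule wsum_mem)
  define D where "D = (\<lambda>\<Lambda>. (l - \<Lambda>) * (1 / (z - \<Lambda>)) ^ 2)"
  define S where "S = (\<Sum>\<^sub>\<infinity>\<Lambda>\<in>unity_roots. 128 * height \<Lambda> ^ 6 * bwd_weight c r \<Lambda>)"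
  have D: "wsummable D"
  proof (rule wsummable_height)
    fix \<Lambda>
    assume \<Lambda>: "\<Lambda> \<in> unity_roots"
    show "cmod (D \<Lambda>) \<le> 32 * height \<Lambda> ^ 4"
    proof (cases "\<Lambda> = l")
      case False
      have "cmod (D \<Lambda>) = cmod (l - \<Lambda>) * cmod (1 / (z - \<Lambda>)) ^ 2"
        unfolding D_def norm_mult norm_power ..
      also have "\<dots> \<le> 2 * (4 * height \<Lambda> ^ 2) ^ 2"
        using inverse_distance_le(2)[OF \<Lambda> False z] norm_triangle_ineq4[of l \<Lambda>] cmod_l cmod_unity_root[OF \<Lambda>]
        by (intro mult_mono power_mono) auto
      finally show ?thesis
        by (simp add: power_mult_distrib flip: power_mult)
    qed (use height_ge_1[OF \<Lambda>] in \<open>simp add: D_def\<close>)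
  qed
  have le: "nrm B (smul B (1 / (v - z)) (wsum (kernel v) - wsum (kernel z)) - wsum D) \<le> cmod (v - z) * S"
    and nonneg: "0 \<le> nrm B (smul B (1 / (v - z)) (wsum (kernel v) - wsum (kernel z)) - wsum D)"
    if v: "v \<in> disks" "v \<noteq> z" for v
  proof -
    let ?k = "\<lambda>\<Lambda>. 1 / (v - z) * (kernel v \<Lambda> - kernel z \<Lambda>)"
    have k0: "wsummable (\<lambda>\<Lambda>. kernel v \<Lambda> - kernel z \<Lambda>)"
      using wsummable_add[OF wsummable_kernel[OF v(1)] wsummable_cmult[OF wsummable_kernel[OF z], of "-1"]]
      by simp
    have "smul B (1 / (v - z)) (wsum (kernel v) - wsum (kernel z)) - wsum D = wsum ?k - wsum D"
      using wsum_cmult[OF k0, of "1 / (v - z)"] wsum_diff[OF wsummable_kernel[OF v(1)] wsummable_kernel[OF z]]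
      by simp
    also have "\<dots> = wsum (\<lambda>\<Lambda>. ?k \<Lambda> - D \<Lambda>)"
      using wsum_diff[OF wsummable_cmult[OF k0] D, of "1 / (v - z)"] by simp
    finally have eq: "smul B (1 / (v - z)) (wsum (kernel v) - wsum (kernel z)) - wsum D
        = wsum (\<lambda>\<Lambda>. ?k \<Lambda> - D \<Lambda>)" .
    have bound: "cmod (?k \<Lambda> - D \<Lambda>) \<le> 128 * cmod (v - z) * height \<Lambda> ^ 6" if "\<Lambda> \<in> unity_roots" for \<Lambda>
      using kernel_difference_quotient[OF that z v] by (simp add: D_def)
    have "nrm B (wsum (\<lambda>\<Lambda>. ?k \<Lambda> - D \<Lambda>)) \<le>
        (\<Sum>\<^sub>\<infinity>\<Lambda>\<in>unity_roots. 128 * cmod (v - z) * height \<Lambda> ^ 6 * bwd_weight c r \<Lambda>)"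
      using height_summable bound by (rule nrm_wsum_le')
    also have "\<dots> = (\<Sum>\<^sub>\<infinity>\<Lambda>\<in>unity_roots. cmod (v - z) * (128 * height \<Lambda> ^ 6 * bwd_weight c r \<Lambda>))"
      by (simp only: mult_ac)
    also have "\<dots> = cmod (v - z) * S"
      unfolding S_def by (intro infsum_cmult_right height_summable)
    finally show "nrm B (smul B (1 / (v - z)) (wsum (kernel v) - wsum (kernel z)) - wsum D) \<le> cmod (v - z) * S"
      unfolding eq .
    show "0 \<le> nrm B (smul B (1 / (v - z)) (wsum (kernel v) - wsum (kernel z)) - wsum D)"
      unfolding eq using wsummable_height[OF bound] by (intro nrm_nonneg wsum_mem)
  qed
  have "((\<lambda>v. cmod (v - z) * S) \<longlongrightarrow> cmod (z - z) * S) (at z within disks)"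
    by (intro tendsto_intros)
  then have lim: "((\<lambda>v. cmod (v - z) * S) \<longlongrightarrow> 0) (at z within disks)"
    by simp
  have "((\<lambda>v. nrm B (smul B (1 / (v - z)) (wsum (kernel v) - wsum (kernel z)) - wsum D)) \<longlongrightarrow> 0) (at z within disks)"
    by (rule tendsto_sandwich[OF _ _ tendsto_const lim]) (use le nonneg in \<open>auto simp: eventually_at_filter\<close>)
  then show "norm_tendsto B (\<lambda>v. smul B (1 / (v - z)) (wsum (kernel v) - wsum (kernel z))) (wsum D) (at z within disks)"
    using wsum_mem[OF D] by (simp add: norm_tendsto_def)
qed

text \<open>The kernel remainders add up to a moment of order N + 2, hence to (N+2)! times s^(N+2).
  Two powers of \<open>s\<close> go into the leading constant, the others into the base of the
  exponential.\<close>

lemma wsum_kernel_remainder: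
  assumes q: "q \<in> disks"
  defines "S \<equiv> (\<Sum>\<^sub>\<infinity>\<Lambda>\<in>unity_roots. sqrt r ^ root_order \<Lambda> / real (root_order \<Lambda>))"
    and "s \<equiv> real (root_order l) / (- ln r / 2)"
  shows "nrm B (wsum (kernel q) - (\<Sum>n<N. smul B ((q - l) ^ n) (wsum (kernel_coeff n))))
    \<le> (8 * s\<^sup>2 * c * (S + 1)) * (4 * s) ^ N * Gamma (1 + real N) * cmod (q - l) ^ N"
proof -
  have s: "s > 0" and S: "S \<ge> 0"
    using r root_order_pos[OF l] by (auto simp: s_def S_def intro!: infsum_nonneg divide_neg_neg divide_pos_neg)
  let ?k = "\<lambda>\<Lambda>. \<Sum>n<N. (q - l) ^ n * kernel_coeff n \<Lambda>"
  have k: "wsummable ?k" "wsum ?k = (\<Sum>n<N. smul B ((q - l) ^ n) (wsum (kernel_coeff n)))"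
    using wsummable_kernel_coeff by (simp_all add: wsum_sum wsum_cmult wsummable_cmult wsummable_sum)
  \<comment> \<open>Lowering the factorial to N! costs an exponential factor only: (N+1)(N+2) grows
    by (N+3)/(N+1) \<le> 3 in each step.\<close>
  have fact: "fact (N + 2) \<le> 2 * 4 ^ N * (fact N :: real)"
  proof -
    have "real ((N + 1) * (N + 2)) \<le> 2 * 4 ^ N"
    proof (induction N)
      case (Suc N)
      have "real ((Suc N + 1) * (Suc N + 2)) \<le> 4 * real ((N + 1) * (N + 2))"
        by (simp add: algebra_simps)
      also have "\<dots> \<le> 4 * (2 * 4 ^ N)"
        using Suc by (rule mult_left_mono) simp
      finally show ?case
        by simp
    qed simp
    then have "real ((N + 1) * (N + 2)) * fact N \<le> 2 * 4 ^ N * fact N"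
      by (intro mult_right_mono) auto
    moreover have "fact (N + 2) = real ((N + 1) * (N + 2)) * fact N"
      by (simp add: algebra_simps)
    ultimately show ?thesis
      by simp
  qed
  have "nrm B (wsum (kernel q) - wsum ?k) = nrm B (wsum (\<lambda>\<Lambda>. kernel q \<Lambda> - ?k \<Lambda>))"
    using wsum_diff[OF wsummable_kernel[OF q] k(1)] by simp
  also have "\<dots> \<le> (\<Sum>\<^sub>\<infinity>\<Lambda>\<in>unity_roots. 4 * cmod (q - l) ^ N * height \<Lambda> ^ (N + 2) *
      bwd_weight c r \<Lambda>)"
    using kernel_remainder q by (intro nrm_wsum_le' height_summable) auto
  also have "\<dots> \<le> 4 * cmod (q - l) ^ N * real (root_order l) ^ (N + 2) * c * (fact (N + 2) / (- ln r / 2) ^ (N + 2) * S)"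
    unfolding S_def by (rule height_moment) simp
  also have "\<dots> = 4 * cmod (q - l) ^ N * c * s ^ (N + 2) * (fact (N + 2) * S)"
    unfolding s_def power_divide by (simp only: times_divide_eq_left times_divide_eq_right mult_ac)
  \<comment> \<open>With \<open>S + 1\<close> in place of \<open>S\<close> the final constant is
    positive as soon as \<open>S \<ge> 0\<close>.\<close>
  also have "\<dots> \<le> 4 * cmod (q - l) ^ N * c * s ^ (N + 2) * (2 * 4 ^ N * fact N * (S + 1))"
    using fact S s c by (intro mult_left_mono mult_mono) auto
  also have "\<dots> = (8 * s\<^sup>2 * c * (S + 1)) * (4 * s) ^ N * Gamma (1 + real N) * cmod (q - l) ^ N"
    by (simp add: Gamma_fact power_add power_mult_distrib power2_eq_square mult_ac)
  finally show ?thesis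
    by (simp only: k(2))
qed

lemma gevrey1_expansion_bwd_series:
  "gevrey1_expansion l B (\<lambda>q. smul B (q - l) (bwd_series B a q)) (Abs_fps (\<lambda>n. wsum (kernel_coeff n)))"
proof -
  define S where "S = (\<Sum>\<^sub>\<infinity>\<Lambda>\<in>unity_roots. sqrt r ^ root_order \<Lambda> / real (root_order \<Lambda>))"
  define s where "s = real (root_order l) / (- ln r / 2)"
  have s: "s > 0" and S: "S \<ge> 0"
    using r root_order_pos[OF l] by (auto simp: s_def S_def intro!: infsum_nonneg divide_neg_neg divide_pos_neg)
  have hol: "vec_holomorphic_on B (\<lambda>q. smul B (q - l) (bwd_series B a q)) disks"
    using vec_holomorphic_wsum_kernel by (rule vec_holomorphic_on_cong) (simp add: smul_bwd_series)
  show ?thesis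
    unfolding gevrey1_expansion_def
  proof (intro conjI allI exI ballI)
    show "0 < 8 * s\<^sup>2 * c * (S + 1)" "0 < 4 * s"
      using s S c by auto
    show "disk_tangent_at l (inner_disk l)" "disk_tangent_at l (outer_disk l)"
      "inner_disk l \<subseteq> {q. cmod q < 1}" "outer_disk l \<subseteq> {q. cmod q > 1}"
      using cmod_l by (auto intro: inner_disk_tangent outer_disk_tangent
          dest: subsetD[OF inner_disk_subset] subsetD[OF outer_disk_subset])
  qed (use hol wsum_kernel_remainder wsum_mem wsummable_kernel_coeff smul_bwd_series in
      \<open>auto simp: disks_def s_def S_def\<close>)
qed

end

section \<open>Banach spaces of holomorphic functions and of operators\<close>

text \<open>One inequality for scalar multiples implies homogeneity: the converse is the same
  inequality for the scalar 1/c applied to \<open>smul B c x\<close>.\<close>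

lemma complex_normed_spaceI:
  assumes "vector_space (smul B)"
    and "0 \<in> vecs B" "\<And>x y. x \<in> vecs B \<Longrightarrow> y \<in> vecs B \<Longrightarrow> x + y \<in> vecs B"
      "\<And>c x. x \<in> vecs B \<Longrightarrow> smul B c x \<in> vecs B"
    and "\<And>x. x \<in> vecs B \<Longrightarrow> 0 \<le> nrm B x" "\<And>x. x \<in> vecs B \<Longrightarrow> nrm B x = 0 \<Longrightarrow> x = 0"
    and smul_le: "\<And>c x. x \<in> vecs B \<Longrightarrow> nrm B (smul B c x) \<le> cmod c * nrm B x"
    and "\<And>x y. x \<in> vecs B \<Longrightarrow> y \<in> vecs B \<Longrightarrow> nrm B (x + y) \<le> nrm B x + nrm B y"
  shows "complex_normed_space B"
proof -
  interpret vector_space "smul B"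
    by fact
  have "nrm B 0 = 0"
    using smul_le[of 0 0] assms(2) assms(5)[of 0] by simp
  moreover have "nrm B (smul B c x) = cmod c * nrm B x" if x: "x \<in> vecs B" for c x
  proof (cases "c = 0")
    case False
    have "nrm B x = nrm B (smul B (1 / c) (smul B c x))"
      using False by simp
    also have "\<dots> \<le> cmod (1 / c) * nrm B (smul B c x)"
      using x by (intro smul_le assms(4))
    finally have "cmod c * nrm B x \<le> nrm B (smul B c x)"
      using False by (simp add: norm_divide field_simps)
    then show ?thesis
      using smul_le[OF x, of c] by simp
  qed (use \<open>nrm B 0 = 0\<close> in simp)
  ultimately show ?thesis
    unfolding complex_normed_space_def using assms by (auto intro: subspaceI)
qed

section \<open>The space of bounded holomorphic functions\<close>

lemma
  shows vecs_bounded_hol: "vecs (bounded_hol r) = {g. g holomorphic_on ball 0 r \<and>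
      bounded (g ` ball 0 r) \<and> g 0 = 0 \<and> (\<forall>z. z \<notin> ball 0 r \<longrightarrow> g z = 0)}"
    and smul_bounded_hol: "smul (bounded_hol r) = (\<lambda>c g z. c * g z)"
    and nrm_bounded_hol: "nrm (bounded_hol r) = (\<lambda>g. SUP z\<in>ball 0 r. cmod (g z))"
  by (simp_all add: bounded_hol_def)

lemma cmod_le_nrm_bounded_hol:
  assumes "g \<in> vecs (bounded_hol r)" "z \<in> ball 0 r"
  shows "cmod (g z) \<le> nrm (bounded_hol r) g"
proof -
  have "bounded (g ` ball 0 r)"
    using assms by (simp add: vecs_bounded_hol)
  then obtain C where "\<forall>x\<in>g ` ball 0 r. cmod x \<le> C"
    by (auto simp: bounded_iff)
  then have "bdd_above ((\<lambda>z. cmod (g z)) ` ball 0 r)"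
    by (intro bdd_aboveI2[of _ _ C]) blast
  then show ?thesis
    unfolding nrm_bounded_hol using assms(2) by (intro cSUP_upper)
qed

lemma nrm_bounded_hol_le:
  assumes "r > 0" "\<And>z. z \<in> ball 0 r \<Longrightarrow> cmod (g z) \<le> C"
  shows "nrm (bounded_hol r) g \<le> C"
  unfolding nrm_bounded_hol using assms by (intro cSUP_least) auto

lemma complex_normed_space_bounded_hol:
  assumes r: "r > 0"
  shows "complex_normed_space (bounded_hol r)"
proof (rule complex_normed_spaceI)
  show "vector_space (smul (bounded_hol r))"
    by unfold_locales (auto simp: smul_bounded_hol fun_eq_iff algebra_simps)
  show "0 \<in> vecs (bounded_hol r)"
    by (auto simp: vecs_bounded_hol zero_fun_def bounded_iff)
next
  fix f g
  assume fg: "f \<in> vecs (bounded_hol r)" "g \<in> vecs (bounded_hol r)"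
  have "bounded ((\<lambda>z. f z + g z) ` ball 0 r)"
    using fg by (auto simp: vecs_bounded_hol intro: bounded_plus_comp)
  then show "f + g \<in> vecs (bounded_hol r)"
    using fg by (auto simp: vecs_bounded_hol plus_fun_def intro: holomorphic_intros)
  show "nrm (bounded_hol r) (f + g) \<le> nrm (bounded_hol r) f + nrm (bounded_hol r) g"
    using fg by (intro nrm_bounded_hol_le r)
      (auto intro!: order_trans[OF norm_triangle_ineq] add_mono cmod_le_nrm_bounded_hol)
next
  fix c g
  assume g: "g \<in> vecs (bounded_hol r)"
  have le: "cmod (smul (bounded_hol r) c g z) \<le> cmod c * nrm (bounded_hol r) g" if "z \<in> ball 0 r" for z
    using cmod_le_nrm_bounded_hol[OF g that] by (simp add: smul_bounded_hol norm_mult mult_left_mono)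
  then have "bounded ((\<lambda>z. c * g z) ` ball 0 r)"
    unfolding bounded_iff smul_bounded_hol by blast
  then show "smul (bounded_hol r) c g \<in> vecs (bounded_hol r)"
    using g by (auto simp: vecs_bounded_hol smul_bounded_hol intro: holomorphic_intros)
  show "nrm (bounded_hol r) (smul (bounded_hol r) c g) \<le> cmod c * nrm (bounded_hol r) g"
    using r le by (rule nrm_bounded_hol_le)
next
  fix g
  assume g: "g \<in> vecs (bounded_hol r)"
  show "0 \<le> nrm (bounded_hol r) g"
    using cmod_le_nrm_bounded_hol[OF g, of 0] r by (simp add: order_trans[OF norm_ge_zero])
  assume "nrm (bounded_hol r) g = 0"
  then have "g z = 0" if "z \<in> ball 0 r" for z
    using cmod_le_nrm_bounded_hol[OF g that] by simp
  then show "g = 0"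
    using g by (auto simp: vecs_bounded_hol fun_eq_iff)
qed

text \<open>A Cauchy sequence for the sup norm converges uniformly on the disk, and uniform limits
  of holomorphic functions are holomorphic.\<close>

lemma complex_banach_space_bounded_hol:
  assumes r: "r > 0"
  shows "complex_banach_space (bounded_hol r)"
proof -
  interpret complex_normed "bounded_hol r"
    using complex_normed_space_bounded_hol[OF r] by unfold_locales
  have "\<exists>g\<in>vecs (bounded_hol r). (\<lambda>n. nrm (bounded_hol r) (X n - g)) \<longlonglongrightarrow> 0"
    if X: "range X \<subseteq> vecs (bounded_hol r)"
      and Cauchy: "\<forall>e>0. \<exists>M. \<forall>m\<ge>M. \<forall>n\<ge>M. nrm (bounded_hol r) (X m - X n) < e" for X
  proof -
    have Xn: "X n \<in> vecs (bounded_hol r)" for n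
      using X by auto
    have diff: "cmod (X m z - X n z) \<le> nrm (bounded_hol r) (X m - X n)" if "z \<in> ball 0 r" for m n z
      using cmod_le_nrm_bounded_hol[OF diff_mem[OF Xn Xn] that, of m n] by simp
    have "\<forall>e>0. \<exists>N. \<forall>m n z. N \<le> m \<and> N \<le> n \<and> z \<in> ball 0 r \<longrightarrow> dist (X m z) (X n z) < e"
    proof (intro allI impI)
      fix e :: real
      assume "e > 0"
      then obtain N where "\<And>m n. m \<ge> N \<Longrightarrow> n \<ge> N \<Longrightarrow> nrm (bounded_hol r) (X m - X n) < e"
        using Cauchy by blast
      then show "\<exists>N. \<forall>m n z. N \<le> m \<and> N \<le> n \<and> z \<in> ball 0 r \<longrightarrow> dist (X m z) (X n z) < e"
        unfolding dist_norm by (intro exI[of _ N] allI impI order_le_less_trans[OF diff]) blast+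
    qed
    then obtain h where h: "\<forall>e>0. \<exists>N. \<forall>n z. N \<le> n \<and> z \<in> ball 0 r \<longrightarrow> dist (X n z) (h z) < e"
      unfolding uniformly_convergent_eq_cauchy[of "\<lambda>z. z \<in> ball 0 r" X, symmetric] by (elim exE)
    \<comment> \<open>The values of \<open>h\<close> outside the disk are arbitrary, whereas
      elements of the space vanish there.\<close>
    define g where "g z = (if z \<in> ball 0 r then h z else 0)" for z
    have ulim: "uniform_limit (ball 0 r) X g sequentially"
      unfolding uniform_limit_sequentially_iff
    proof (intro allI impI)
      fix e :: real
      assume "e > 0"
      then obtain N where "\<And>n z. N \<le> n \<Longrightarrow> z \<in> ball 0 r \<Longrightarrow> dist (X n z) (h z) < e"
        using h by blast
      then show "\<exists>N. \<forall>n\<ge>N. \<forall>z\<in>ball 0 r. dist (X n z) (g z) < e"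
        by (intro exI[of _ N]) (simp add: g_def)
    qed
    have lim: "(\<lambda>n. X n z) \<longlonglongrightarrow> g z" if "z \<in> ball 0 r" for z
      using tendsto_uniform_limitI[OF ulim that] .
    have "g holomorphic_on ball 0 r"
    proof (rule holomorphic_uniform_sequence)
      show "\<exists>d>0. cball z d \<subseteq> ball 0 r \<and> uniform_limit (cball z d) X g sequentially"
        if z: "z \<in> ball 0 r" for z
      proof -
        obtain d where "d > 0" "cball z d \<subseteq> ball 0 r"
          using z open_contains_cball[of "ball 0 r :: complex set"] open_ball by blast
        then show ?thesis
          using uniform_limit_on_subset[OF ulim] by blast
      qed
    qed (use Xn in \<open>auto simp: vecs_bounded_hol\<close>)
    moreover have "g 0 = 0"
      using lim[of 0] Xn r LIMSEQ_unique[of "\<lambda>n. X n 0" "g 0" 0] by (simp add: vecs_bounded_hol)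
    moreover have "bounded (g ` ball 0 r)"
    proof -
      obtain N where N: "\<And>n z. N \<le> n \<Longrightarrow> z \<in> ball 0 r \<Longrightarrow> dist (X n z) (h z) < 1"
        using h zero_less_one by blast
      have "cmod (g z) \<le> nrm (bounded_hol r) (X N) + 1" if "z \<in> ball 0 r" for z
        using N[OF order_refl that] cmod_le_nrm_bounded_hol[OF Xn that, of N] that
          norm_triangle_ineq4[of "X N z" "X N z - h z"] by (simp add: g_def dist_norm)
      then show ?thesis
        unfolding bounded_iff by blast
    qed
    moreover have "\<forall>z. z \<notin> ball 0 r \<longrightarrow> g z = 0"
      by (simp add: g_def)
    ultimately have g: "g \<in> vecs (bounded_hol r)"
      unfolding vecs_bounded_hol mem_Collect_eq by (intro conjI)
    have "(\<lambda>n. nrm (bounded_hol r) (X n - g)) \<longlonglongrightarrow> 0"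
    proof (rule LIMSEQ_I)
      fix e :: real
      assume e: "e > 0"
      then obtain N where N: "\<And>n z. N \<le> n \<Longrightarrow> z \<in> ball 0 r \<Longrightarrow> dist (X n z) (h z) < e / 2"
        using h[THEN spec, of "e / 2"] by auto
      have le: "nrm (bounded_hol r) (X n - g) \<le> e / 2" if "n \<ge> N" for n
        using N[OF that] by (intro nrm_bounded_hol_le r) (auto simp: g_def dist_norm intro: less_imp_le)
      have "norm (nrm (bounded_hol r) (X n - g) - 0) < e" if "n \<ge> N" for n
        using le[OF that] nrm_nonneg[OF diff_mem[OF Xn g], of n] e by simp
      then show "\<exists>N. \<forall>n\<ge>N. norm (nrm (bounded_hol r) (X n - g) - 0) < e"
        by blast
    qed
    then show ?thesis
      using g by blast
  qed
  note * = this
  show ?thesis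
    unfolding complex_banach_space_def
    by (intro conjI allI impI normed) (elim conjE, rule *)
qed

section \<open>The space of bounded operators\<close>

locale operator_space = V: complex_normed V + W: complex_normed W
  for V :: "'v::ab_group_add cspace" and W :: "'w::ab_group_add cspace"
begin

abbreviation L :: "('v \<Rightarrow> 'w) cspace" where
  "L \<equiv> bounded_operators V W"

lemma
  shows vecs_bounded_operators: "vecs L = {T. (\<forall>x\<in>vecs V. T x \<in> vecs W) \<and>
      (\<forall>x. x \<notin> vecs V \<longrightarrow> T x = 0) \<and> (\<forall>x\<in>vecs V. \<forall>y\<in>vecs V. T (x + y) = T x + T y) \<and>
      (\<forall>c. \<forall>x\<in>vecs V. T (smul V c x) = smul W c (T x)) \<and>
      (\<exists>K. \<forall>x\<in>vecs V. nrm W (T x) \<le> K * nrm V x)}"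
    and smul_bounded_operators: "smul L = (\<lambda>c T x. smul W c (T x))"
    and nrm_bounded_operators: "nrm L = (\<lambda>T. SUP x\<in>{x \<in> vecs V. nrm V x \<le> 1}. nrm W (T x))"
  by (simp_all add: bounded_operators_def)

lemma operatorD:
  assumes "T \<in> vecs L"
  shows "x \<in> vecs V \<Longrightarrow> T x \<in> vecs W" "x \<notin> vecs V \<Longrightarrow> T x = 0"
    "x \<in> vecs V \<Longrightarrow> y \<in> vecs V \<Longrightarrow> T (x + y) = T x + T y"
    "x \<in> vecs V \<Longrightarrow> T (smul V c x) = smul W c (T x)"
  using assms by (auto simp: vecs_bounded_operators)

lemma operator_zero: "T \<in> vecs L \<Longrightarrow> T 0 = 0"
  using operatorD(4)[of T 0 0] by simp

lemma nrm_operator_le: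
  assumes K: "K \<ge> 0" and le: "\<And>x. x \<in> vecs V \<Longrightarrow> nrm W (T x) \<le> K * nrm V x"
  shows "nrm L T \<le> K"
  unfolding nrm_bounded_operators
proof (rule cSUP_least)
  have "0 \<in> {x \<in> vecs V. nrm V x \<le> 1}"
    by simp
  then show "{x \<in> vecs V. nrm V x \<le> 1} \<noteq> {}"
    by blast
  show "nrm W (T x) \<le> K" if "x \<in> {x \<in> vecs V. nrm V x \<le> 1}" for x
    using le[of x] that K mult_left_mono[of "nrm V x" 1 K] by simp
qed

lemma
  assumes T: "T \<in> vecs L"
  shows nrm_operator_nonneg: "0 \<le> nrm L T"
    and nrm_apply_le: "x \<in> vecs V \<Longrightarrow> nrm W (T x) \<le> nrm L T * nrm V x"
proof -
  let ?U = "{x \<in> vecs V. nrm V x \<le> 1}"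
  obtain K where K: "\<And>x. x \<in> vecs V \<Longrightarrow> nrm W (T x) \<le> K * nrm V x"
    using T unfolding vecs_bounded_operators mem_Collect_eq by blast
  have "bdd_above ((\<lambda>x. nrm W (T x)) ` ?U)"
  proof (rule bdd_aboveI2)
    fix x
    assume x: "x \<in> ?U"
    \<comment> \<open>The bound \<open>K\<close> may be negative when the domain is trivial, hence
      the absolute value.\<close>
    then have "K * nrm V x \<le> \<bar>K\<bar> * 1"
      using V.nrm_nonneg[of x] by (intro mult_mono) auto
    then show "nrm W (T x) \<le> \<bar>K\<bar>"
      using K[of x] x by simp
  qed
  then have unit: "nrm W (T x) \<le> nrm L T" if "x \<in> vecs V" "nrm V x \<le> 1" for x
    unfolding nrm_bounded_operators using that by (intro cSUP_upper) auto
  show "0 \<le> nrm L T"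
    using unit[of 0] operator_zero[OF T] by simp
  assume x: "x \<in> vecs V"
  show "nrm W (T x) \<le> nrm L T * nrm V x"
  proof (cases "x = 0")
    case False
    then have pos: "nrm V x > 0"
      using x V.nrm_nonneg[OF x] V.nrm_eq_0[OF x] by simp
    let ?c = "complex_of_real (1 / nrm V x)"
    have c: "cmod ?c = 1 / nrm V x"
      using pos by (simp add: norm_divide)
    have "nrm W (T (smul V ?c x)) \<le> nrm L T"
      using x pos by (intro unit V.smul_mem) (simp_all only: V.nrm_smul c, simp)
    also have "nrm W (T (smul V ?c x)) = nrm W (T x) / nrm V x"
      using operatorD[OF T] x by (simp only: W.nrm_smul c) simp
    finally show ?thesis
      using pos by (simp add: field_simps)
  qed (simp add: operator_zero[OF T])
qed

lemma operatorI:
  assumes "\<And>x. x \<in> vecs V \<Longrightarrow> T x \<in> vecs W" "\<And>x. x \<notin> vecs V \<Longrightarrow> T x = 0"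
    "\<And>x y. x \<in> vecs V \<Longrightarrow> y \<in> vecs V \<Longrightarrow> T (x + y) = T x + T y"
    "\<And>c x. x \<in> vecs V \<Longrightarrow> T (smul V c x) = smul W c (T x)"
    "\<And>x. x \<in> vecs V \<Longrightarrow> nrm W (T x) \<le> K * nrm V x"
  shows "T \<in> vecs L"
  unfolding vecs_bounded_operators mem_Collect_eq
  by (intro conjI ballI allI impI exI[of _ K] assms)

lemma complex_normed_space_operators: "complex_normed_space L"
proof (rule complex_normed_spaceI)
  show "vector_space (smul L)"
    by unfold_locales
      (auto simp: smul_bounded_operators fun_eq_iff W.scale_right_distrib W.scale_left_distrib)
  show "0 \<in> vecs L"
    by (rule operatorI[where K = 0]) auto
next
  fix S T
  assume S: "S \<in> vecs L" and T: "T \<in> vecs L"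
  have le: "nrm W ((S + T) x) \<le> (nrm L S + nrm L T) * nrm V x" if "x \<in> vecs V" for x
    using nrm_apply_le[OF S that] nrm_apply_le[OF T that] operatorD(1)[OF S that] operatorD(1)[OF T that]
      W.nrm_triangle[of "S x" "T x"] by (simp add: distrib_right)
  then show "S + T \<in> vecs L"
    using operatorD[OF S] operatorD[OF T]
    by (intro operatorI[of _ "nrm L S + nrm L T"]) (auto simp: W.add_mem algebra_simps W.scale_right_distrib)
  show "nrm L (S + T) \<le> nrm L S + nrm L T"
    using le nrm_operator_nonneg[OF S] nrm_operator_nonneg[OF T] by (intro nrm_operator_le) auto
next
  fix c T
  assume T: "T \<in> vecs L"
  have le: "nrm W (smul L c T x) \<le> cmod c * nrm L T * nrm V x" if "x \<in> vecs V" for x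
    using nrm_apply_le[OF T that] operatorD(1)[OF T that]
    by (simp add: smul_bounded_operators W.nrm_smul mult.assoc mult_left_mono)
  then show "smul L c T \<in> vecs L"
    using operatorD[OF T]
    by (intro operatorI[of _ "cmod c * nrm L T"])
      (auto simp: smul_bounded_operators W.smul_mem W.scale_right_distrib mult.commute)
  show "nrm L (smul L c T) \<le> cmod c * nrm L T"
    using le nrm_operator_nonneg[OF T] by (intro nrm_operator_le) auto
next
  fix T
  assume T: "T \<in> vecs L"
  show "0 \<le> nrm L T"
    using T by (rule nrm_operator_nonneg)
  assume "nrm L T = 0"
  then have "T x = 0" if "x \<in> vecs V" for x
    using nrm_apply_le[OF T that] operatorD(1)[OF T that] W.nrm_nonneg[of "T x"] W.nrm_eq_0[of "T x"] by simp
  then show "T = 0"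
    using operatorD(2)[OF T] by (auto simp: fun_eq_iff)
qed

end

text \<open>The limit is taken pointwise, which needs completeness of the target, and the Cauchy
  bound then shows the convergence to be uniform on the unit ball.\<close>

lemma complex_banach_space_bounded_operators:
  assumes V: "complex_normed_space V" and W: "complex_banach_space W"
  shows "complex_banach_space (bounded_operators V W)"
proof -
  interpret W: complex_banach W
    using W by unfold_locales
  interpret operator_space V W
    using V by unfold_locales
  interpret L: complex_normed L
    using complex_normed_space_operators by unfold_locales
  have "\<exists>T\<in>vecs L. (\<lambda>n. nrm L (X n - T)) \<longlonglongrightarrow> 0"
    if X: "range X \<subseteq> vecs L" and Cauchy: "\<forall>e>0. \<exists>M. \<forall>m\<ge>M. \<forall>n\<ge>M. nrm L (X m - X n) < e" for X
  proof -
    have Xn: "X n \<in> vecs L" for n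
      using X by auto
    have diff: "nrm W (X m x - X n x) \<le> nrm L (X m - X n) * nrm V x" if "x \<in> vecs V" for m n x
      using nrm_apply_le[OF L.diff_mem[OF Xn Xn] that, of m n] by simp
    have "\<exists>y. norm_tendsto W (\<lambda>n. X n x) y sequentially" if x: "x \<in> vecs V" for x
    proof -
      have "\<exists>M. \<forall>m\<ge>M. \<forall>n\<ge>M. nrm W (X m x - X n x) < e" if e: "e > 0" for e
      proof -
        \<comment> \<open>Adding 1 avoids a division by zero at x = 0.\<close>
        have pos: "e / (nrm V x + 1) > 0" "nrm V x + 1 > 0"
          using e V.nrm_nonneg[OF x] by (auto intro: divide_pos_pos)
        obtain M where M: "\<And>m n. m \<ge> M \<Longrightarrow> n \<ge> M \<Longrightarrow> nrm L (X m - X n) < e / (nrm V x + 1)"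
          using Cauchy pos(1) by blast
        have "nrm W (X m x - X n x) < e" if "m \<ge> M" "n \<ge> M" for m n
        proof -
          have "nrm L (X m - X n) * nrm V x \<le> nrm L (X m - X n) * (nrm V x + 1)"
            using nrm_operator_nonneg[OF L.diff_mem[OF Xn Xn]] by (intro mult_left_mono) auto
          also have "\<dots> < e"
            using M[OF that] pos by (simp add: field_simps)
          finally show ?thesis
            using diff[OF x, of m n] by simp
        qed
        then show ?thesis
          by blast
      qed
      then have "\<exists>y\<in>vecs W. (\<lambda>n. nrm W (X n x - y)) \<longlonglongrightarrow> 0"
        using W operatorD(1)[OF Xn x]
        unfolding complex_banach_space_def by (elim conjE allE[of _ "\<lambda>n. X n x"]) auto
      then show ?thesis
        by (auto simp: norm_tendsto_def)
    qed
    then obtain Y where Y: "\<And>x. x \<in> vecs V \<Longrightarrow> norm_tendsto W (\<lambda>n. X n x) (Y x) sequentially"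
      by metis
    define T where "T x = (if x \<in> vecs V then Y x else 0)" for x
    have T: "norm_tendsto W (\<lambda>n. X n x) (T x) sequentially" if "x \<in> vecs V" for x
      using Y[OF that] that by (simp add: T_def)
    have T_mem: "T x \<in> vecs W" if "x \<in> vecs V" for x
      using T[OF that] by (simp add: norm_tendsto_def)
    \<comment> \<open>Let m tend to infinity in the Cauchy bound for \<open>X n x - X m x\<close>.
      The index found depends on \<open>e\<close> only, not on \<open>x\<close>.\<close>
    have approx: "\<exists>N. \<forall>n\<ge>N. \<forall>x\<in>vecs V. nrm W (X n x - T x) \<le> e * nrm V x" if e: "e > 0" for e
    proof -
      obtain M where M: "\<And>m n. m \<ge> M \<Longrightarrow> n \<ge> M \<Longrightarrow> nrm L (X m - X n) < e"
        using Cauchy e by blast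
      have "nrm W (X n x - T x) \<le> e * nrm V x" if n: "n \<ge> M" and x: "x \<in> vecs V" for n x
      proof (rule W.norm_tendsto_bound)
        have "(\<lambda>m. nrm W (X n x - X m x - (X n x - T x))) = (\<lambda>m. nrm W (X m x - T x))"
          using W.nrm_minus_commute[OF T_mem[OF x] operatorD(1)[OF Xn x]] by (simp add: fun_eq_iff)
        then show "norm_tendsto W (\<lambda>m. X n x - X m x) (X n x - T x) sequentially"
          using T[OF x] T_mem[OF x] operatorD(1)[OF Xn x] by (simp add: norm_tendsto_def W.diff_mem)
        have "nrm W (X n x - X m x) \<le> e * nrm V x" if "m \<ge> M" for m
          using diff[OF x, of n m] M[OF n that] V.nrm_nonneg[OF x]
          by (meson less_imp_le mult_right_mono order_trans)
        then show "\<forall>\<^sub>F m in sequentially. X n x - X m x \<in> vecs W \<and> nrm W (X n x - X m x) \<le> e * nrm V x"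
          using operatorD(1)[OF Xn x] W.diff_mem unfolding eventually_sequentially by blast
      qed simp
      then show ?thesis
        by blast
    qed
    have "T \<in> vecs L"
    proof -
      obtain N where N: "\<And>x. x \<in> vecs V \<Longrightarrow> nrm W (X N x - T x) \<le> 1 * nrm V x"
        using approx[of 1] by auto
      show ?thesis
      proof (rule operatorI)
        fix x y c
        assume x: "x \<in> vecs V"
        show "T x \<in> vecs W"
          using x by (rule T_mem)
        have ev: "\<forall>\<^sub>F n in sequentially. X n x \<in> vecs W"
          using operatorD(1)[OF Xn x] by simp
        have "norm_tendsto W (\<lambda>n. X n (smul V c x)) (smul W c (T x)) sequentially"
          using W.norm_tendsto_smul[OF T[OF x] ev] operatorD(4)[OF Xn x] by simp
        then show "T (smul V c x) = smul W c (T x)"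
          using W.norm_tendsto_unique[OF T[OF V.smul_mem[OF x]]] operatorD(1)[OF Xn V.smul_mem[OF x]] by simp
        show "nrm W (T x) \<le> (nrm L (X N) + 1) * nrm V x"
          using N[OF x] nrm_apply_le[OF Xn x, of N] operatorD(1)[OF Xn x] T_mem[OF x]
            W.nrm_le_add_diff[of "T x" "X N x"] W.nrm_minus_commute[of "T x" "X N x"]
          by (simp add: distrib_right)
        assume y: "y \<in> vecs V"
        have "\<forall>\<^sub>F n in sequentially. X n x \<in> vecs W \<and> X n y \<in> vecs W"
          using operatorD(1)[OF Xn x] operatorD(1)[OF Xn y] by simp
        then have "norm_tendsto W (\<lambda>n. X n (x + y)) (T x + T y) sequentially"
          using W.norm_tendsto_add[OF T[OF x] T[OF y]] operatorD(3)[OF Xn x y] by simp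
        then show "T (x + y) = T x + T y"
          using W.norm_tendsto_unique[OF T[OF V.add_mem[OF x y]]] operatorD(1)[OF Xn V.add_mem[OF x y]] by simp
      qed (simp add: T_def)
    qed
    moreover have "(\<lambda>n. nrm L (X n - T)) \<longlonglongrightarrow> 0"
    proof (rule LIMSEQ_I)
      fix e :: real
      assume e: "e > 0"
      then obtain N where N: "\<And>n x. n \<ge> N \<Longrightarrow> x \<in> vecs V \<Longrightarrow> nrm W (X n x - T x) \<le> e / 2 * nrm V x"
        using approx[of "e / 2"] by auto
      have le: "nrm L (X n - T) \<le> e / 2" if "n \<ge> N" for n
        using N[OF that] e by (intro nrm_operator_le) auto
      have "norm (nrm L (X n - T) - 0) < e" if "n \<ge> N" for n
        using le[OF that] nrm_operator_nonneg[OF L.diff_mem[OF Xn \<open>T \<in> vecs L\<close>], of n] e by simp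
      then show "\<exists>N. \<forall>n\<ge>N. norm (nrm L (X n - T) - 0) < e"
        by blast
    qed
    ultimately show ?thesis
      by blast
  qed
  note * = this
  show ?thesis
    unfolding complex_banach_space_def
    by (intro conjI allI impI complex_normed_space_operators) (elim conjE, rule *)
qed

section \<open>The solution of the cohomological equation\<close>

text \<open>Multiplication by a primitive root \<omega> permutes the roots, so the sum is fixed by
  the factor \<omega>^j, which differs from 1.\<close>

lemma sum_powers_roots_unity:
  assumes j: "0 < j" "j < n"
  shows "(\<Sum>\<Lambda> | \<Lambda> ^ n = 1. \<Lambda> ^ j) = (0 :: complex)"
proof -
  define \<omega> where "\<omega> = cis (2 * pi / real n)"
  have n: "n > 0"
    using j by simp
  have \<omega>: "\<omega> ^ k = cis (2 * pi * real k / real n)" for k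
    by (simp add: \<omega>_def Complex.DeMoivre mult_ac)
  have "inj_on (\<lambda>k. \<omega> ^ k) {..<n}"
    using Complex.bij_betw_roots_unity[OF n] by (simp add: \<omega> bij_betw_def)
  then have "\<omega> ^ j \<noteq> 1"
    using inj_onD[of "\<lambda>k. \<omega> ^ k" "{..<n}" j 0] j by auto
  have "\<omega> ^ n = 1"
    using n by (simp add: \<omega>)
  then have "bij_betw (\<lambda>\<Lambda>. \<omega> * \<Lambda>) {\<Lambda>. \<Lambda> ^ n = 1} {\<Lambda>. \<Lambda> ^ n = 1}"
    using n by (intro bij_betwI[where g = "\<lambda>\<Lambda>. \<Lambda> / \<omega>"]) (auto simp: power_mult_distrib power_divide \<omega>_def)
  then have "(\<Sum>\<Lambda> | \<Lambda> ^ n = 1. (\<omega> * \<Lambda>) ^ j) = (\<Sum>\<Lambda> | \<Lambda> ^ n = 1. \<Lambda> ^ j)"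
    by (rule sum.reindex_bij_betw)
  then have "\<omega> ^ j * (\<Sum>\<Lambda> | \<Lambda> ^ n = 1. \<Lambda> ^ j) = (\<Sum>\<Lambda> | \<Lambda> ^ n = 1. \<Lambda> ^ j)"
    by (simp add: power_mult_distrib sum_distrib_left)
  then show ?thesis
    using \<open>\<omega> ^ j \<noteq> 1\<close> by simp
qed

text \<open>The residue of 1/(q^n - 1) at a root \<Lambda> is \<Lambda>/n. For the proof, (q^n -
  1)/(q - \<Lambda>) is expanded in powers of \<open>q\<close>, and the sum over \<Lambda> is
  carried out coefficient by coefficient.\<close>

lemma partial_fractions_roots_unity:
  fixes q :: complex
  assumes n: "n > 0" and q: "q ^ n \<noteq> 1"
  shows "(\<Sum>\<Lambda> | \<Lambda> ^ n = 1. \<Lambda> / (q - \<Lambda>)) = of_nat n / (q ^ n - 1)"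
proof -
  have "(q ^ n - 1) * (\<Lambda> / (q - \<Lambda>)) = (\<Sum>i<n. \<Lambda> ^ (n - i) * q ^ i)" if \<Lambda>: "\<Lambda> ^ n = 1" for \<Lambda>
  proof -
    have "q - \<Lambda> \<noteq> 0"
      using \<Lambda> q by auto
    have "q ^ n - 1 = (q - \<Lambda>) * (\<Sum>i<n. \<Lambda> ^ (n - Suc i) * q ^ i)"
      using power_diff_sumr2[of q n \<Lambda>] \<Lambda> by simp
    then have "(q ^ n - 1) * (\<Lambda> / (q - \<Lambda>)) = \<Lambda> * (\<Sum>i<n. \<Lambda> ^ (n - Suc i) * q ^ i)"
      using \<open>q - \<Lambda> \<noteq> 0\<close> by simp
    also have "\<dots> = (\<Sum>i<n. \<Lambda> ^ Suc (n - Suc i) * q ^ i)"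
      by (simp add: sum_distrib_left mult.assoc)
    also have "\<dots> = (\<Sum>i<n. \<Lambda> ^ (n - i) * q ^ i)"
      by (intro sum.cong) (simp_all add: Suc_diff_Suc del: power_Suc)
    finally show ?thesis .
  qed
  then have "(q ^ n - 1) * (\<Sum>\<Lambda> | \<Lambda> ^ n = 1. \<Lambda> / (q - \<Lambda>)) = (\<Sum>\<Lambda> | \<Lambda> ^ n = 1. \<Sum>i<n. \<Lambda> ^ (n - i) * q ^ i)"
    by (simp add: sum_distrib_left)
  also have "\<dots> = (\<Sum>i<n. (\<Sum>\<Lambda> | \<Lambda> ^ n = 1. \<Lambda> ^ (n - i)) * q ^ i)"
    by (subst sum.swap) (simp add: sum_distrib_right)
  \<comment> \<open>The exponent n - i lies strictly between 0 and n unless i = 0, where each of the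
    n roots contributes 1.\<close>
  also have "\<dots> = (\<Sum>i<n. if i = 0 then of_nat n else 0)"
  proof (rule sum.cong)
    fix i
    assume "i \<in> {..<n}"
    then show "(\<Sum>\<Lambda> | \<Lambda> ^ n = 1. \<Lambda> ^ (n - i)) * q ^ i = (if i = 0 then of_nat n else 0)"
      using sum_powers_roots_unity[of "n - i" n] card_roots_unity_eq[OF n] by (cases "i = 0") auto
  qed simp
  also have "\<dots> = of_nat n"
    using n by simp
  finally show ?thesis
    using q by (simp add: field_simps)
qed

section \<open>Taylor coefficients and Hadamard multipliers\<close>

lemma bounded_hol_has_fps_expansion:
  assumes "g \<in> vecs (bounded_hol r)" "r > 0"
  shows "g has_fps_expansion fps_expansion g 0"
  using assms by (intro has_fps_expansion_fps_expansion[of "ball 0 r"]) (auto simp: vecs_bounded_hol)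

text \<open>Cauchy's inequality needs continuity up to the boundary, so it is applied on radii s <
  r, and s then tends to r.\<close>

lemma cmod_fps_nth_bounded_hol_le:
  assumes g: "g \<in> vecs (bounded_hol r)" and r: "r > 0"
  shows "cmod (fps_nth (fps_expansion g 0) n) * r ^ n \<le> nrm (bounded_hol r) g"
proof -
  let ?c = "fps_nth (fps_expansion g 0) n"
  have "cmod ?c * s ^ n \<le> nrm (bounded_hol r) g" if s: "0 < s" "s < r" for s
  proof -
    have hol: "g holomorphic_on ball 0 r"
      using g by (simp add: vecs_bounded_hol)
    have "cmod ((deriv ^^ n) g 0) \<le> fact n * nrm (bounded_hol r) g / s ^ n"
    proof (rule Cauchy_inequality)
      show "g holomorphic_on ball 0 s"
        using s by (intro holomorphic_on_subset[OF hol]) auto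
      show "continuous_on (cball 0 s) g"
        using s by (intro holomorphic_on_imp_continuous_on holomorphic_on_subset[OF hol]) auto
      show "cmod (g x) \<le> nrm (bounded_hol r) g" if "cmod (0 - x) = s" for x
        using that s by (intro cmod_le_nrm_bounded_hol[OF g]) simp
    qed (use s in simp)
    then show ?thesis
      using s by (simp add: fps_expansion_def norm_divide field_simps)
  qed
  then have "eventually (\<lambda>s. cmod ?c * s ^ n \<le> nrm (bounded_hol r) g) (at_left r)"
    using r eventually_at_left_real[of 0 r] by (auto elim: eventually_mono)
  moreover have "((\<lambda>s. cmod ?c * s ^ n) \<longlongrightarrow> cmod ?c * r ^ n) (at_left r)"
    by (intro tendsto_intros)
  ultimately show ?thesis
    by (intro tendsto_upperbound[where F = "at_left r"]) simp_all
qed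

lemma bounded_hol_fps_nth_0:
  assumes "g \<in> vecs (bounded_hol r)"
  shows "fps_nth (fps_expansion g 0) 0 = 0"
  using assms by (simp add: fps_expansion_def vecs_bounded_hol)

definition multiplier ::
    "real \<Rightarrow> real \<Rightarrow> (nat \<Rightarrow> complex) \<Rightarrow> (complex \<Rightarrow> complex) \<Rightarrow> complex \<Rightarrow> complex" where
  "multiplier r1 r2 \<mu> =
     as_operator r1 r2 (\<lambda>g z. \<Sum>n. \<mu> n * fps_nth (fps_expansion g 0) n * z ^ n)"

lemma multiplier_term_le:
  assumes g: "g \<in> vecs (bounded_hol r1)" and r: "0 < r2" "r2 < r1" and z: "z \<in> ball 0 r2"
  shows "cmod (\<mu> n * fps_nth (fps_expansion g 0) n * z ^ n)
    \<le> cmod (\<mu> n) * (r2 / r1) ^ n * nrm (bounded_hol r1) g"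
proof -
  let ?c = "fps_nth (fps_expansion g 0) n"
  have "cmod (?c * z ^ n) \<le> cmod ?c * r2 ^ n"
    using z by (simp add: norm_mult norm_power mult_left_mono power_mono)
  also have "\<dots> = (r2 / r1) ^ n * (cmod ?c * r1 ^ n)"
    using r by (simp add: power_divide)
  also have "\<dots> \<le> (r2 / r1) ^ n * nrm (bounded_hol r1) g"
    using r by (intro mult_left_mono cmod_fps_nth_bounded_hol_le[OF g]) auto
  finally have "cmod (\<mu> n) * cmod (?c * z ^ n) \<le> cmod (\<mu> n) * ((r2 / r1) ^ n * nrm (bounded_hol r1) g)"
    by (intro mult_left_mono) auto
  then show ?thesis
    by (simp only: norm_mult mult.assoc)
qed

text \<open>By Cauchy's estimates the n-th Taylor coefficient of \<open>g\<close> is at most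
  \<parallel>g\<parallel> / r1^n, so on the smaller disk the series is dominated by powers of r2/r1.
  The last two claims provide the pointwise absolute convergence used to interchange sums.\<close>

lemma
  assumes r: "0 < r2" "r2 < r1" and \<mu>: "summable (\<lambda>n. cmod (\<mu> n) * (r2 / r1) ^ n)"
  shows multiplier_mem: "multiplier r1 r2 \<mu> \<in> vecs (hol_operators r1 r2)"
    and nrm_multiplier_le:
      "nrm (hol_operators r1 r2) (multiplier r1 r2 \<mu>) \<le> (\<Sum>n. cmod (\<mu> n) * (r2 / r1) ^ n)"
    and multiplier_summable: "g \<in> vecs (bounded_hol r1) \<Longrightarrow> z \<in> ball 0 r2 \<Longrightarrow>
      summable (\<lambda>n. cmod (\<mu> n * fps_nth (fps_expansion g 0) n * z ^ n))"
    and multiplier_le: "g \<in> vecs (bounded_hol r1) \<Longrightarrow> z \<in> ball 0 r2 \<Longrightarrow>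
      (\<Sum>n. cmod (\<mu> n * fps_nth (fps_expansion g 0) n * z ^ n))
        \<le> (\<Sum>n. cmod (\<mu> n) * (r2 / r1) ^ n) * nrm (bounded_hol r1) g"
proof -
  interpret V: complex_normed "bounded_hol r1"
    using r by unfold_locales (simp add: complex_normed_space_bounded_hol)
  interpret W: complex_normed "bounded_hol r2"
    using r by unfold_locales (simp add: complex_normed_space_bounded_hol)
  interpret operator_space "bounded_hol r1" "bounded_hol r2" ..
  let ?t = "\<lambda>g z n. \<mu> n * fps_nth (fps_expansion g 0) n * z ^ n"
  let ?S = "\<Sum>n. cmod (\<mu> n) * (r2 / r1) ^ n"
  let ?T = "multiplier r1 r2 \<mu>"
  have S: "?S \<ge> 0"
    using r \<mu> by (intro suminf_nonneg) auto
  have abs: "summable (\<lambda>n. cmod (?t g z n))" and le: "(\<Sum>n. cmod (?t g z n)) \<le> ?S * nrm (bounded_hol r1) g"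
    if gz: "g \<in> vecs (bounded_hol r1)" "z \<in> ball 0 r2" for g z
  proof -
    have b: "summable (\<lambda>n. cmod (\<mu> n) * (r2 / r1) ^ n * nrm (bounded_hol r1) g)"
      using \<mu> by (rule summable_mult2)
    show a: "summable (\<lambda>n. cmod (?t g z n))"
      using multiplier_term_le[OF gz(1) r gz(2), of \<mu>] by (intro summable_comparison_test'[OF b]) simp
    show "(\<Sum>n. cmod (?t g z n)) \<le> ?S * nrm (bounded_hol r1) g"
      unfolding suminf_mult2[OF \<mu>] using multiplier_term_le[OF gz(1) r gz(2), of \<mu>] by (intro suminf_le a b)
  qed
  show "summable (\<lambda>n. cmod (?t g z n))" "(\<Sum>n. cmod (?t g z n)) \<le> ?S * nrm (bounded_hol r1) g"
    if "g \<in> vecs (bounded_hol r1)" "z \<in> ball 0 r2"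
    using abs le that by blast+
  have eq: "?T g z = (\<Sum>n. ?t g z n)" if "g \<in> vecs (bounded_hol r1)" "z \<in> ball 0 r2" for g z
    using that by (simp add: multiplier_def as_operator_def)
  have outside: "?T g z = 0" if "z \<notin> ball 0 r2" for g z
    using that by (simp add: multiplier_def as_operator_def)
  have bound: "cmod (?T g z) \<le> ?S * nrm (bounded_hol r1) g"
    if gz: "g \<in> vecs (bounded_hol r1)" "z \<in> ball 0 r2" for g z
    unfolding eq[OF gz] using summable_norm[OF abs[OF gz]] le[OF gz] by simp
  have nrm_le: "nrm (bounded_hol r2) (?T g) \<le> ?S * nrm (bounded_hol r1) g"
    if "g \<in> vecs (bounded_hol r1)" for g
    using r bound[OF that] by (intro nrm_bounded_hol_le) auto
  have "?T \<in> vecs L"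
  proof (rule operatorI)
    fix f g c
    show "?T g = 0" if "g \<notin> vecs (bounded_hol r1)"
      using that by (simp add: multiplier_def as_operator_def zero_fun_def)
    assume g: "g \<in> vecs (bounded_hol r1)"
    show "nrm (bounded_hol r2) (?T g) \<le> ?S * nrm (bounded_hol r1) g"
      using nrm_le[OF g] .
    have "?T g holomorphic_on ball 0 r2"
    proof (rule power_series_holomorphic)
      fix z :: complex
      assume z: "z \<in> ball 0 r2"
      show "(\<lambda>n. \<mu> n * fps_nth (fps_expansion g 0) n * (z - 0) ^ n) sums ?T g z"
        unfolding eq[OF g z] using summable_norm_cancel[OF abs[OF g z]] by (simp add: summable_sums)
    qed
    moreover have "bounded (?T g ` ball 0 r2)"
      using bound[OF g] unfolding bounded_iff by blast
    moreover have "?T g 0 = 0"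
      using eq[OF g, of 0] r bounded_hol_fps_nth_0[OF g] by (simp add: powser_zero)
    moreover have "\<forall>z. z \<notin> ball 0 r2 \<longrightarrow> ?T g z = 0"
      using outside by blast
    ultimately show "?T g \<in> vecs (bounded_hol r2)"
      unfolding vecs_bounded_hol mem_Collect_eq by (intro conjI)
    have g_fps: "g has_fps_expansion fps_expansion g 0"
      using bounded_hol_has_fps_expansion[OF g] r by simp
    have cg: "smul (bounded_hol r1) c g \<in> vecs (bounded_hol r1)"
      using g by (rule V.smul_mem)
    have "fps_expansion (smul (bounded_hol r1) c g) 0 = fps_const c * fps_expansion g 0"
      unfolding smul_bounded_hol by (intro fps_expansion_eqI has_fps_expansion_cmult_left g_fps)
    then have t: "?t (smul (bounded_hol r1) c g) z n = c * ?t g z n" for z n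
      by simp
    show "?T (smul (bounded_hol r1) c g) = smul (bounded_hol r2) c (?T g)"
    proof
      fix z
      show "?T (smul (bounded_hol r1) c g) z = smul (bounded_hol r2) c (?T g) z"
      proof (cases "z \<in> ball 0 r2")
        case True
        show ?thesis
          unfolding eq[OF cg True] t suminf_mult[OF summable_norm_cancel[OF abs[OF g True]]]
          by (simp add: smul_bounded_hol eq[OF g True])
      qed (simp add: smul_bounded_hol outside)
    qed
    assume f: "f \<in> vecs (bounded_hol r1)"
    have f_fps: "f has_fps_expansion fps_expansion f 0"
      using bounded_hol_has_fps_expansion[OF f] r by simp
    have fg: "f + g \<in> vecs (bounded_hol r1)"
      using f g by (rule V.add_mem)
    have "fps_expansion (f + g) 0 = fps_expansion f 0 + fps_expansion g 0"
      unfolding plus_fun_def by (intro fps_expansion_eqI has_fps_expansion_add f_fps g_fps)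
    then have t: "?t (f + g) z n = ?t f z n + ?t g z n" for z n
      by (simp add: algebra_simps)
    show "?T (f + g) = ?T f + ?T g"
    proof
      fix z
      show "?T (f + g) z = (?T f + ?T g) z"
      proof (cases "z \<in> ball 0 r2")
        case True
        show ?thesis
          unfolding eq[OF fg True] t plus_fun_apply eq[OF f True] eq[OF g True]
          by (intro suminf_add[symmetric] summable_norm_cancel[OF abs[OF f True]]
              summable_norm_cancel[OF abs[OF g True]])
      qed (simp add: outside)
    qed
  qed
  then show "?T \<in> vecs (hol_operators r1 r2)"
    by (simp add: hol_operators_def)
  show "nrm (hol_operators r1 r2) ?T \<le> ?S"
    unfolding hol_operators_def using S nrm_le by (rule nrm_operator_le)
qed

section \<open>The logarithmic multipliers\<close>

text \<open>Taylor coefficients of \<open>log_fun m\<close>, namely 1/(m k) at n = m k. At n = 0 the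
  value is 1/0 = 0, as it should be.\<close>

definition log_coeff :: "nat \<Rightarrow> nat \<Rightarrow> complex" where
  "log_coeff m n = (if m dvd n then 1 / of_nat n else 0)"

lemma log_fun_sums:
  assumes m: "m > 0" and z: "cmod z < 1"
  shows "(\<lambda>n. log_coeff m n * z ^ n) sums log_fun m z"
proof -
  have "cmod (- (z ^ m)) < 1"
    using m z by (simp add: norm_power power_less_one_iff)
  from Ln_series'[OF this] have "(\<lambda>k. - (1 / of_nat m) * (- ((z ^ m) ^ k) / of_nat k)) sums log_fun m z"
    unfolding log_fun_def by (intro sums_mult) simp
  \<comment> \<open>For k = 0 both sides are zero because division by zero yields 0.\<close>
  moreover have "- (1 / of_nat m) * (- ((z ^ m) ^ k) / of_nat k) = log_coeff m (m * k) * z ^ (m * k)" for k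
    by (simp add: log_coeff_def power_mult)
  ultimately have "(\<lambda>k. log_coeff m (m * k) * z ^ (m * k)) sums log_fun m z"
    by simp
  moreover have "strict_mono (\<lambda>k. m * k)"
    using m by (intro strict_monoI) simp
  ultimately show ?thesis
    by (subst (asm) sums_mono_reindex) (auto simp: log_coeff_def elim: dvdE)
qed

lemma fps_nth_log_fun:
  assumes "m > 0"
  shows "fps_nth (fps_expansion (log_fun m) 0) n = log_coeff m n"
proof -
  have "eventually (\<lambda>z. z \<in> ball 0 1) (nhds (0 :: complex))"
    by (intro eventually_nhds_in_open) auto
  then have "eventually (\<lambda>z. (\<lambda>n. fps_nth (Abs_fps (log_coeff m)) n * z ^ n) sums log_fun m z) (nhds 0)"
    by eventually_elim (simp add: log_fun_sums[OF assms])
  then have "fps_expansion (log_fun m) 0 = Abs_fps (log_coeff m)"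
    by (intro fps_expansion_eqI has_fps_expansionI)
  then show ?thesis
    by simp
qed

lemma hadamard_log_fun_eq_multiplier:
  assumes "m > 0"
  shows "as_operator r1 r2 (hadamard_prod (log_fun m)) = multiplier r1 r2 (log_coeff m)"
  unfolding multiplier_def by (simp add: hadamard_prod_def[abs_def] fps_nth_log_fun[OF assms])

text \<open>Nonzero coefficients occur only at indices n \<ge> m, where 1/n \<le> 1/m. The geometric
  tail starting at m therefore yields exactly the decay demanded of a Borel-Wolff-Denjoy
  family.\<close>

lemma
  fixes \<rho> :: real
  assumes m: "m > 0" and \<rho>: "0 < \<rho>" "\<rho> < 1"
  shows log_coeff_summable: "summable (\<lambda>n. cmod (log_coeff m n) * \<rho> ^ n)"
    and log_coeff_suminf_le: "(\<Sum>n. cmod (log_coeff m n) * \<rho> ^ n) \<le> 1 / (1 - \<rho>) * (\<rho> ^ m / real m)"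
proof -
  let ?f = "\<lambda>n. if n < m then 0 else \<rho> ^ n / real m"
  have "(\<lambda>k. \<rho> ^ m / real m * \<rho> ^ k) sums (\<rho> ^ m / real m * (1 / (1 - \<rho>)))"
    using \<rho> by (intro sums_mult geometric_sums) auto
  then have "(\<lambda>k. ?f (k + m)) sums (1 / (1 - \<rho>) * (\<rho> ^ m / real m))"
    by (simp add: power_add mult_ac)
  then have f: "?f sums (1 / (1 - \<rho>) * (\<rho> ^ m / real m))"
    by (subst (asm) sums_zero_iff_shift) auto
  have le: "cmod (log_coeff m n) * \<rho> ^ n \<le> ?f n" for n
  proof (cases "m dvd n \<and> n > 0")
    case True
    then have "m \<le> n"
      by (auto dest: dvd_imp_le)
    then show ?thesis
      using True \<rho> m by (simp add: log_coeff_def norm_divide frac_le)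
  next
    case False
    then show ?thesis
      using \<rho> m by (auto simp: log_coeff_def)
  qed
  show s: "summable (\<lambda>n. cmod (log_coeff m n) * \<rho> ^ n)"
    using le \<rho> by (intro summable_comparison_test'[OF sums_summable[OF f]]) auto
  show "(\<Sum>n. cmod (log_coeff m n) * \<rho> ^ n) \<le> 1 / (1 - \<rho>) * (\<rho> ^ m / real m)"
    using suminf_le[OF le s sums_summable[OF f]] sums_unique[OF f] by simp
qed

section \<open>The solution as a Borel-Wolff-Denjoy series\<close>

text \<open>The residue of the solution at \<Lambda>: 1/(q^n - 1) has residue \<Lambda>/n there when
  the order of \<Lambda> divides n, and no pole otherwise.\<close>

definition cohom_family :: "real \<Rightarrow> real \<Rightarrow> complex \<Rightarrow> (complex \<Rightarrow> complex) \<Rightarrow> complex \<Rightarrow> complex" where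
  "cohom_family r1 r2 \<Lambda> = smul (hol_operators r1 r2) \<Lambda>
     (as_operator r1 r2 (hadamard_prod (log_fun (root_order \<Lambda>))))"

lemma complex_banach_space_hol_operators:
  assumes "0 < r2" "r2 < r1"
  shows "complex_banach_space (hol_operators r1 r2)"
  unfolding hol_operators_def using assms
  by (intro complex_banach_space_bounded_operators complex_normed_space_bounded_hol
      complex_banach_space_bounded_hol) auto

lemma bwd_family_cohom:
  assumes r: "0 < r2" "r2 < r1" and l: "l \<in> unity_roots"
  shows "bwd_family (hol_operators r1 r2) (cohom_family r1 r2) (r2 / r1) (1 / (1 - r2 / r1)) l"
proof -
  interpret complex_banach "hol_operators r1 r2"
    using complex_banach_space_hol_operators[OF r] by unfold_locales
  have \<rho>: "0 < r2 / r1" "r2 / r1 < 1"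
    using r by auto
  show ?thesis
  proof unfold_locales
    fix \<Lambda>
    assume \<Lambda>: "\<Lambda> \<in> unity_roots"
    note m = root_order_pos[OF \<Lambda>]
    note T = multiplier_mem[OF r log_coeff_summable[OF m \<rho>]]
    show "cohom_family r1 r2 \<Lambda> \<in> vecs (hol_operators r1 r2)"
      unfolding cohom_family_def hadamard_log_fun_eq_multiplier[OF m] using T by (rule smul_mem)
    show "nrm (hol_operators r1 r2) (cohom_family r1 r2 \<Lambda>) \<le> bwd_weight (1 / (1 - r2 / r1)) (r2 / r1) \<Lambda>"
      unfolding cohom_family_def hadamard_log_fun_eq_multiplier[OF m] nrm_smul[OF T] bwd_weight_def
        cmod_unity_root[OF \<Lambda>]
      using nrm_multiplier_le[OF r log_coeff_summable[OF m \<rho>]] log_coeff_suminf_le[OF m \<rho>] by linarith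
  qed (use \<rho> l in auto)
qed

lemma sum_fun_apply: "sum F X x = (\<Sum>i\<in>X. F i x)"
  for F :: "'i \<Rightarrow> 'a \<Rightarrow> 'b::comm_monoid_add"
  by (induction X rule: infinite_finite_induct) auto

text \<open>Both sides are evaluated at \<open>g\<close> and \<open>z\<close>. The series becomes a
  double sum over roots \<Lambda> and Taylor indices n. After an interchange, the sum over \<Lambda>
  for fixed n is the partial fraction expansion of 1/(q^n - 1).\<close>

lemma bwd_series_cohom_family:
  assumes r12: "0 < r2" "r2 < r1" and q: "cmod q \<noteq> 1"
  shows "bwd_series (hol_operators r1 r2) (cohom_family r1 r2) q = cohom_solution r1 r2 q"
proof -
  have one: "1 \<in> unity_roots"
    by (rule unity_rootsI[of _ 1]) auto
  \<comment> \<open>The base point 1 is an arbitrary choice. The series itself does not depend on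
    it.\<close>
  interpret bwd_family "hol_operators r1 r2" "cohom_family r1 r2" "r2 / r1" "1 / (1 - r2 / r1)" 1
    using bwd_family_cohom[OF r12 one] .
  interpret V: complex_normed "bounded_hol r1"
    using r12 by unfold_locales (simp add: complex_normed_space_bounded_hol)
  interpret W: complex_normed "bounded_hol r2"
    using r12 by unfold_locales (simp add: complex_normed_space_bounded_hol)
  interpret O: operator_space "bounded_hol r1" "bounded_hol r2" ..
  let ?F = "\<lambda>\<Lambda>. smul (hol_operators r1 r2) (1 / (q - \<Lambda>)) (cohom_family r1 r2 \<Lambda>)"
  define s where "s = bwd_series (hol_operators r1 r2) (cohom_family r1 r2) q"
  have lim: "norm_tendsto (hol_operators r1 r2) (sum ?F) s (finite_subsets_at_top unity_roots)"
    unfolding s_def using q by (rule bwd_series_tendsto)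
  then have s: "s \<in> vecs (hol_operators r1 r2)"
    by (simp add: norm_tendsto_def)
  have "s g z = cohom_solution r1 r2 q g z" for g z
  proof (cases "g \<in> vecs (bounded_hol r1) \<and> z \<in> ball 0 r2")
    case False
    have "s g z = 0"
    proof (cases "g \<in> vecs (bounded_hol r1)")
      case True
      then have "s g \<in> vecs (bounded_hol r2)"
        by (rule O.operatorD(1)[folded hol_operators_def, OF s])
      then show ?thesis
        using True False unfolding vecs_bounded_hol mem_Collect_eq by blast
    next
      case False
      then have "s g = 0"
        by (rule O.operatorD(2)[folded hol_operators_def, OF s])
      then show ?thesis
        by simp
    qed
    then show ?thesis
      using False by (auto simp: cohom_solution_def as_operator_def)
  next
    case True
    then have g: "g \<in> vecs (bounded_hol r1)" and z: "z \<in> ball 0 r2"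
      by auto
    define b where "b n = fps_nth (fps_expansion g 0) n * z ^ n" for n
    define f where "f \<Lambda> n = \<Lambda> / (q - \<Lambda>) * (log_coeff (root_order \<Lambda>) n * b n)" for \<Lambda> n
    have \<rho>: "0 < r2 / r1" "r2 / r1 < 1"
      using r12 by auto
    have abs: "summable (\<lambda>n. cmod (log_coeff (root_order \<Lambda>) n * b n))"
      "(\<Sum>n. cmod (log_coeff (root_order \<Lambda>) n * b n))
        \<le> 1 / (1 - r2 / r1) * ((r2 / r1) ^ root_order \<Lambda> / real (root_order \<Lambda>)) * nrm (bounded_hol r1) g"
      if "\<Lambda> \<in> unity_roots" for \<Lambda>
    proof -
      note m = root_order_pos[OF that]
      show "summable (\<lambda>n. cmod (log_coeff (root_order \<Lambda>) n * b n))"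
        using multiplier_summable[OF r12 log_coeff_summable[OF m \<rho>] g z] by (simp add: b_def mult.assoc)
      have "(\<Sum>n. cmod (log_coeff (root_order \<Lambda>) n * b n))
          \<le> (\<Sum>n. cmod (log_coeff (root_order \<Lambda>) n) * (r2 / r1) ^ n) * nrm (bounded_hol r1) g"
        using multiplier_le[OF r12 log_coeff_summable[OF m \<rho>] g z] by (simp add: b_def mult.assoc)
      also have "\<dots> \<le> 1 / (1 - r2 / r1) * ((r2 / r1) ^ root_order \<Lambda> / real (root_order \<Lambda>)) * nrm (bounded_hol r1) g"
        using log_coeff_suminf_le[OF m \<rho>] V.nrm_nonneg[OF g] by (rule mult_right_mono)
      finally show "(\<Sum>n. cmod (log_coeff (root_order \<Lambda>) n * b n))
        \<le> 1 / (1 - r2 / r1) * ((r2 / r1) ^ root_order \<Lambda> / real (root_order \<Lambda>)) * nrm (bounded_hol r1) g" .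
    qed
    have F: "?F \<Lambda> g z = (\<Sum>\<^sub>\<infinity>n. f \<Lambda> n)" if \<Lambda>: "\<Lambda> \<in> unity_roots" for \<Lambda>
    proof -
      have "?F \<Lambda> g z = \<Lambda> / (q - \<Lambda>) * (\<Sum>n. log_coeff (root_order \<Lambda>) n * b n)"
        using g z unfolding cohom_family_def hadamard_log_fun_eq_multiplier[OF root_order_pos[OF \<Lambda>]]
        by (simp add: hol_operators_def O.smul_bounded_operators smul_bounded_hol multiplier_def
            as_operator_def b_def mult.assoc)
      also have "\<dots> = \<Lambda> / (q - \<Lambda>) * (\<Sum>\<^sub>\<infinity>n. log_coeff (root_order \<Lambda>) n * b n)"
        using infsumI[OF norm_summable_imp_has_sum[OF abs(1)[OF \<Lambda>] summable_sums[OF summable_norm_cancel[OF abs(1)[OF \<Lambda>]]]]]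
        by simp
      also have "\<dots> = (\<Sum>\<^sub>\<infinity>n. f \<Lambda> n)"
        unfolding f_def by (rule infsum_cmult_right'[symmetric])
      finally show ?thesis .
    qed
    \<comment> \<open>Evaluation at \<open>g\<close> and \<open>z\<close> is bounded by the operator
      norm times \<parallel>g\<parallel>, so convergence in operator norm implies convergence of the
      scalar sums.\<close>
    have "((\<lambda>\<Lambda>. ?F \<Lambda> g z) has_sum s g z) unity_roots"
    proof -
      have le: "cmod (sum (\<lambda>\<Lambda>. ?F \<Lambda> g z) X - s g z) \<le>
          nrm (hol_operators r1 r2) (sum ?F X - s) * nrm (bounded_hol r1) g"
        if X: "X \<subseteq> unity_roots" for X
      proof -
        have "sum ?F X \<in> vecs (hol_operators r1 r2)"
          using X mem by (intro sum_mem smul_mem) auto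
        then have d: "sum ?F X - s \<in> vecs (hol_operators r1 r2)"
          using s by (rule diff_mem)
        have "cmod ((sum ?F X - s) g z) \<le> nrm (bounded_hol r2) ((sum ?F X - s) g)"
          using O.operatorD(1)[folded hol_operators_def, OF d g] z by (rule cmod_le_nrm_bounded_hol)
        also have "\<dots> \<le> nrm (hol_operators r1 r2) (sum ?F X - s) * nrm (bounded_hol r1) g"
          using d g by (rule O.nrm_apply_le[folded hol_operators_def])
        finally show ?thesis
          by (simp add: sum_fun_apply)
      qed
      have ev: "\<forall>\<^sub>F X in finite_subsets_at_top unity_roots.
          cmod (sum (\<lambda>\<Lambda>. ?F \<Lambda> g z) X - s g z) \<le>
          nrm (hol_operators r1 r2) (sum ?F X - s) * nrm (bounded_hol r1) g"
        using le by (rule eventually_finite_subsets_at_top_weakI)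
      have "((\<lambda>X. nrm (hol_operators r1 r2) (sum ?F X - s) * nrm (bounded_hol r1) g) \<longlongrightarrow> 0)
          (finite_subsets_at_top unity_roots)"
        using lim unfolding norm_tendsto_def by (intro tendsto_mult_left_zero) blast
      then have "((\<lambda>X. sum (\<lambda>\<Lambda>. ?F \<Lambda> g z) X - s g z) \<longlongrightarrow> 0) (finite_subsets_at_top unity_roots)"
        by (rule Lim_null_comparison[OF ev])
      then show ?thesis
        unfolding has_sum_def by (simp add: LIM_zero_iff)
    qed
    then have "s g z = (\<Sum>\<^sub>\<infinity>\<Lambda>\<in>unity_roots. ?F \<Lambda> g z)"
      by (rule infsumI[symmetric])
    also have "\<dots> = (\<Sum>\<^sub>\<infinity>\<Lambda>\<in>unity_roots. \<Sum>\<^sub>\<infinity>n. f \<Lambda> n)"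
      using F by (intro infsum_cong)
    finally have s_eq: "s g z = (\<Sum>\<^sub>\<infinity>\<Lambda>\<in>unity_roots. \<Sum>\<^sub>\<infinity>n. f \<Lambda> n)" .
    \<comment> \<open>For fixed \<Lambda> the absolute sum over n is at most a constant times
      (r2/r1)^m / m with m the order of \<Lambda>, which is summable over all roots.\<close>
    have f_summable: "(\<lambda>(\<Lambda>, n). f \<Lambda> n) summable_on unity_roots \<times> UNIV"
    proof -
      have f_abs: "(\<lambda>n. cmod (f \<Lambda> n)) summable_on UNIV"
        "(\<Sum>\<^sub>\<infinity>n. cmod (f \<Lambda> n)) \<le> (1 / \<bar>cmod q - 1\<bar> * (1 / (1 - r2 / r1) * nrm (bounded_hol r1) g)) *
            ((r2 / r1) ^ root_order \<Lambda> / real (root_order \<Lambda>))"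
        if \<Lambda>: "\<Lambda> \<in> unity_roots" for \<Lambda>
      proof -
        have "((\<lambda>n. cmod (log_coeff (root_order \<Lambda>) n * b n)) has_sum
            (\<Sum>n. cmod (log_coeff (root_order \<Lambda>) n * b n))) UNIV"
          using abs(1)[OF \<Lambda>] by (intro norm_summable_imp_has_sum) (auto simp: summable_sums)
        then have hs: "((\<lambda>n. cmod (f \<Lambda> n)) has_sum
            (cmod (\<Lambda> / (q - \<Lambda>)) * (\<Sum>n. cmod (log_coeff (root_order \<Lambda>) n * b n)))) UNIV"
          unfolding f_def norm_mult[of "\<Lambda> / (q - \<Lambda>)"] by (rule has_sum_cmult_right)
        then show "(\<lambda>n. cmod (f \<Lambda> n)) summable_on UNIV"
          by (rule has_sum_imp_summable)
        have "\<bar>cmod q - 1\<bar> \<le> cmod (q - \<Lambda>)"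
          using norm_triangle_ineq3[of q \<Lambda>] cmod_unity_root[OF \<Lambda>] by simp
        then have gap: "cmod (\<Lambda> / (q - \<Lambda>)) \<le> 1 / \<bar>cmod q - 1\<bar>"
          using q cmod_unity_root[OF \<Lambda>] by (simp add: norm_divide frac_le)
        have "(\<Sum>\<^sub>\<infinity>n. cmod (f \<Lambda> n)) = cmod (\<Lambda> / (q - \<Lambda>)) * (\<Sum>n. cmod (log_coeff (root_order \<Lambda>) n * b n))"
          using hs by (rule infsumI)
        also have "\<dots> \<le> 1 / \<bar>cmod q - 1\<bar> *
            (1 / (1 - r2 / r1) * ((r2 / r1) ^ root_order \<Lambda> / real (root_order \<Lambda>)) * nrm (bounded_hol r1) g)"
          using gap abs[OF \<Lambda>] by (intro mult_mono) (auto intro: suminf_nonneg)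
        finally show "(\<Sum>\<^sub>\<infinity>n. cmod (f \<Lambda> n)) \<le>
            (1 / \<bar>cmod q - 1\<bar> * (1 / (1 - r2 / r1) * nrm (bounded_hol r1) g)) *
            ((r2 / r1) ^ root_order \<Lambda> / real (root_order \<Lambda>))"
          by (simp only: mult_ac)
      qed
      have "(\<lambda>\<Lambda>. \<Sum>\<^sub>\<infinity>n. cmod (f \<Lambda> n)) summable_on unity_roots"
      proof (rule summable_on_comparison_test)
        show "(\<lambda>\<Lambda>. (1 / \<bar>cmod q - 1\<bar> * (1 / (1 - r2 / r1) * nrm (bounded_hol r1) g)) *
            ((r2 / r1) ^ root_order \<Lambda> / real (root_order \<Lambda>))) summable_on unity_roots"
          using \<rho> by (intro summable_on_cmult_right summable_on_unity_roots) auto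
      qed (use f_abs(2) in \<open>auto intro: infsum_nonneg\<close>)
      then have "(\<lambda>x. cmod ((\<lambda>(\<Lambda>, n). f \<Lambda> n) x)) summable_on unity_roots \<times> UNIV"
        unfolding Infinite_Sum.abs_summable_on_Sigma_iff using f_abs(1) by (simp add: infsum_nonneg)
      then show "(\<lambda>(\<Lambda>, n). f \<Lambda> n) summable_on unity_roots \<times> UNIV"
        by (rule abs_summable_summable)
    qed
    have sum_f: "(\<Sum>\<^sub>\<infinity>\<Lambda>\<in>unity_roots. f \<Lambda> n) = b n / (q ^ n - 1)" for n
    proof (cases "n = 0")
      \<comment> \<open>Both sides vanish at n = 0: the coefficient is 0, and the right side is a
        division by q^0 - 1 = 0.\<close>
      case True
      then show ?thesis
        by (simp add: f_def log_coeff_def)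
    next
      case False
      have qn: "q ^ n \<noteq> 1"
        using q False by (metis power_eq_1_iff)
      \<comment> \<open>A root contributes to the n-th coefficient exactly when its order divides n,
        that is, when \<Lambda>^n = 1. This leaves a finite sum.\<close>
      have "(\<Sum>\<^sub>\<infinity>\<Lambda>\<in>unity_roots. f \<Lambda> n) = (\<Sum>\<^sub>\<infinity>\<Lambda>\<in>{\<Lambda>. \<Lambda> ^ n = 1}. \<Lambda> / (q - \<Lambda>) * (b n / of_nat n))"
        using False by (intro infsum_cong_neutral)
          (auto simp: f_def log_coeff_def power_eq_1_iff_root_order_dvd dest: unity_rootsI[of _ n])
      also have "\<dots> = (\<Sum>\<Lambda> | \<Lambda> ^ n = 1. \<Lambda> / (q - \<Lambda>)) * (b n / of_nat n)"
        unfolding sum_distrib_right using False by (intro infsum_finite finite_roots_unity) simp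
      also have "\<dots> = b n / (q ^ n - 1)"
        using False qn by (simp add: partial_fractions_roots_unity)
      finally show ?thesis .
    qed
    have bij: "bij_betw prod.swap (UNIV \<times> unity_roots) (unity_roots \<times> (UNIV :: nat set))"
      by (rule bij_betwI[where g = prod.swap]) auto
    have "(\<lambda>(n, \<Lambda>). f \<Lambda> n) summable_on UNIV \<times> unity_roots"
      using f_summable unfolding summable_on_reindex_bij_betw[OF bij, symmetric] by (simp add: case_prod_unfold)
    then have "(\<lambda>n. \<Sum>\<^sub>\<infinity>\<Lambda>\<in>unity_roots. f \<Lambda> n) summable_on UNIV"
      by (rule summable_on_Sigma_banach)
    then have "((\<lambda>n. b n / (q ^ n - 1)) has_sum (\<Sum>\<^sub>\<infinity>n. \<Sum>\<^sub>\<infinity>\<Lambda>\<in>unity_roots. f \<Lambda> n)) UNIV"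
      unfolding sum_f by simp
    then have "((\<lambda>n. b n / (q ^ n - 1)) has_sum s g z) UNIV"
      unfolding s_eq infsum_swap_banach[OF f_summable] .
    then have "(\<lambda>n. b n / (q ^ n - 1)) sums s g z"
      by (rule has_sum_imp_sums)
    \<comment> \<open>The term at n = 0 is a division by zero, hence 0, and the sum may start at 1
      as in \<open>cohom_solution\<close>.\<close>
    then have "(\<lambda>n. b (Suc n) / (q ^ Suc n - 1)) sums s g z"
      by (subst sums_Suc_iff) simp
    then show ?thesis
      using g z by (simp add: cohom_solution_def as_operator_def b_def sums_iff)
  qed
  then show ?thesis
    unfolding s_def by (intro ext)
qed

text \<open>The function \<open>f\<close> is only required to agree with the series off the circle,
  so that the result applies to the series itself and to the solution of the cohomological equation
  alike.\<close>

lemma (in bwd_family) bwd_gevrey1: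
  assumes "\<And>q. cmod q \<noteq> 1 \<Longrightarrow> smul B (q - l) (bwd_series B a q) = f q"
  shows "f \<in> gevrey1 l B" and "fps_nth (asymp_expansion l B f) 0 = a l"
proof -
  have f: "gevrey1_expansion l B f (Abs_fps (\<lambda>n. wsum (kernel_coeff n)))"
    using assms gevrey1_expansion_bwd_series by (rule gevrey1_expansion_cong)
  then show "f \<in> gevrey1 l B"
    by (auto simp: gevrey1_def)
  show "fps_nth (asymp_expansion l B f) 0 = a l"
    unfolding asymp_expansion_eqI[OF cmod_l f] by (simp add: wsum_kernel_coeff_0)
qed

theorem theorem4p1:
  fixes r :: real and B :: "'b::ab_group_add cspace" and \<Lambda>0 :: complex
  assumes "0 < r" and "r < 1"
    and "complex_banach_space B"
    and "\<Lambda>0 \<in> unity_roots"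
  shows "(\<forall>a\<in>bwd_families r B.
            (\<lambda>q. smul B (q - \<Lambda>0) (bwd_series B a q)) \<in> gevrey1 \<Lambda>0 B \<and>
            fps_nth (asymp_expansion \<Lambda>0 B (\<lambda>q. smul B (q - \<Lambda>0) (bwd_series B a q))) 0 = a \<Lambda>0) \<and>
         (\<forall>r1 r2 :: real. 0 < r2 \<and> r2 < r1 \<longrightarrow>
            (\<lambda>q. smul (hol_operators r1 r2) (q - \<Lambda>0) (cohom_solution r1 r2 q))
              \<in> gevrey1 \<Lambda>0 (hol_operators r1 r2) \<and>
            fps_nth (asymp_expansion \<Lambda>0 (hol_operators r1 r2)
                (\<lambda>q. smul (hol_operators r1 r2) (q - \<Lambda>0) (cohom_solution r1 r2 q))) 0
              = smul (hol_operators r1 r2) \<Lambda>0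
                  (as_operator r1 r2 (hadamard_prod (log_fun (root_order \<Lambda>0)))))"
proof (intro conjI ballI allI impI)
  fix a
  assume "a \<in> bwd_families r B"
  then obtain c where "c > 0" and a: "\<And>\<Lambda>. \<Lambda> \<in> unity_roots \<Longrightarrow> a \<Lambda> \<in> vecs B"
      "\<And>\<Lambda>. \<Lambda> \<in> unity_roots \<Longrightarrow> nrm B (a \<Lambda>) \<le> c * r ^ root_order \<Lambda> / real (root_order \<Lambda>)"
    by (auto simp: bwd_families_def)
  then interpret bwd_family B a r c \<Lambda>0
    using assms by unfold_locales (simp_all add: bwd_weight_def)
  show "(\<lambda>q. smul B (q - \<Lambda>0) (bwd_series B a q)) \<in> gevrey1 \<Lambda>0 B"
    "fps_nth (asymp_expansion \<Lambda>0 B (\<lambda>q. smul B (q - \<Lambda>0) (bwd_series B a q))) 0 = a \<Lambda>0"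
    by (rule bwd_gevrey1, rule refl)+
next
  fix r1 r2 :: real
  assume "0 < r2 \<and> r2 < r1"
  then have r12: "0 < r2" "r2 < r1"
    by auto
  \<comment> \<open>The second claim is the first one for the operator space, with the ratio
    \<open>r2 / r1\<close> in the role of \<open>r\<close>.\<close>
  interpret bwd_family "hol_operators r1 r2" "cohom_family r1 r2" "r2 / r1" "1 / (1 - r2 / r1)" \<Lambda>0
    using bwd_family_cohom[OF r12 assms(4)] .
  let ?f = "\<lambda>q. smul (hol_operators r1 r2) (q - \<Lambda>0) (cohom_solution r1 r2 q)"
  have eq: "smul (hol_operators r1 r2) (q - \<Lambda>0) (bwd_series (hol_operators r1 r2) (cohom_family r1 r2) q) = ?f q"
    if "cmod q \<noteq> 1" for q
    using bwd_series_cohom_family[OF r12 that] by simp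
  show "?f \<in> gevrey1 \<Lambda>0 (hol_operators r1 r2)"
    using eq by (rule bwd_gevrey1)
  show "fps_nth (asymp_expansion \<Lambda>0 (hol_operators r1 r2) ?f) 0 =
      smul (hol_operators r1 r2) \<Lambda>0 (as_operator r1 r2 (hadamard_prod (log_fun (root_order \<Lambda>0))))"
    using bwd_gevrey1(2)[of ?f] eq by (simp add: cohom_family_def)
qed

end
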